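(* Let $\lambda\in\mathbb{R}^3$ be strictly decreasing such that $\frac{\lambda_1-\lambda_2}{\lambda_2-\lambda_3}$ lies outside the interval $\big[\frac{1}{2+2\sqrt2},\,2+2\sqrt2\big]$, and let $N\in\mathfrak{u}_3$. Then the gradient flow on $\mathcal{O}_\lambda$ with respect to $N$ in the induced metric does not strictly preserve positivity, and it weakly preserves positivity if and only if $N$ is a scalar multiple of $I_3$ (i.e. the flow is constant).
   Context: Here $n=3$ and $\mathrm{i}=\sqrt{-1}$; $\mathrm{U}_n$ is the unitary group and $\mathfrak{u}_n$ the Lie algebra of skew-Hermitian $n\times n$ matrices. $\mathcal{O}_\lambda=\{g(\mathrm{i}\,\mathrm{Diag}(\lambda))g^{-1}:g\in\mathrm{U}_n\}$. $\mathrm{U}_n^{>0}$ (resp. $\mathrm{U}_n^{\ge 0}$) is the set of $g\in\mathrm{U}_n$ all of whose left-justified minors (row set $I$, column set $\{1,\dots,|I|\}$) are positive (resp. nonnegative) real numbers; $\mathcal{O}_\lambda^{>0}=\{g(\mathrm{i}\,\mathrm{Diag}(\lambda))g^{-1}:g\in\mathrm{U}_n^{>0}\}$, and $\mathcal{O}_\lambda^{\ge 0}$ is its closure, equal to $\{g(\mathrm{i}\,\mathrm{Diag}(\lambda))g^{-1}:g\in\mathrm{U}_n^{\ge 0}\}$. Let $\kappa(L,M)=2n\,\mathrm{tr}(LM)-2\,\mathrm{tr}(L)\mathrm{tr}(M)$. The tangent space of $\mathcal{O}_\lambda$ at $L$ is $\{[L,X]:X\in\mathfrak{u}_n\}$,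 and the induced metric is $\langle[L,X],[L,Y]\rangle_{\mathrm{induced}}=-\kappa([L,X],[L,Y])$. The gradient flow with respect to $N$ is $\dot L(t)=\mathrm{grad}(H)(L(t))$ with $H(M)=\kappa(M,N)$ (steepest ascent), defined for all $t\in\mathbb{R}$; in the induced metric it reads $\dot L(t)=-N^{L(t)}$, where $N^L$ is the component of $N$ in $\mathrm{im}(\mathrm{ad}_L)$ along $\mathfrak{u}_n=\mathrm{im}(\mathrm{ad}_L)\oplus\ker(\mathrm{ad}_L)$, $\mathrm{ad}_L(X)=[L,X]=LX-XL$. A flow on $\mathcal{O}_\lambda$ weakly preserves positivity if $L(t)\in\mathcal{O}_\lambda^{\ge0}$ for all $L(0)\in\mathcal{O}_\lambda^{\ge0}$ and $t\ge0$; it strictly preserves positivity if $L(t)\in\mathcal{O}_\lambda^{>0}$ for all $L(0)\in\mathcal{O}_\lambda^{\ge 0}$ and $t>0$. *)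

theory Defs
  imports "HOL-Analysis.Analysis"
begin

text \<open>
  Matrices are of type \<open>complex^3^3\<close> and their rows and columns are labelled 1, 2, 3.
  In the index type 3 the label 3 is equal to 0, so the built-in order of that type
  is not the order of the labels.  For this reason row sets are sets of naturals below,
  and labels are injected with \<open>of_nat\<close>.
\<close>

definition ctranspose :: "complex^3^3 \<Rightarrow> complex^3^3" where
  "ctranspose A = (\<chi> i j. cnj (A $ j $ i))"

definition unitary_group :: "(complex^3^3) set" where
  "unitary_group = {g. g ** ctranspose g = mat 1 \<and> ctranspose g ** g = mat 1}"

definition skew_hermitian :: "(complex^3^3) set" where
  "skew_hermitian = {X. ctranspose X = - X}"

definition i_diag :: "real^3 \<Rightarrow> complex^3^3" where
  "i_diag l = (\<chi> i j. if i = j then \<i> * complex_of_real (l $ i) else 0)"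

text \<open>
  The Leibniz formula for the determinant of the submatrix of \<open>A\<close> with rows \<open>I\<close>
  (in increasing order) and columns 1, ..., \<open>card I\<close>.
\<close>

definition left_minor :: "complex^3^3 \<Rightarrow> nat set \<Rightarrow> complex" where
  "left_minor A I =
     (\<Sum>p | p permutes {..<card I}.
        of_int (sign p) *
        (\<Prod>r<card I. A $ of_nat (sorted_list_of_set I ! r) $ of_nat (Suc (p r))))"

definition unitary_pos :: "(complex^3^3) set" where
  "unitary_pos = {g \<in> unitary_group.
     \<forall>I. I \<subseteq> {1..3} \<and> I \<noteq> {} \<longrightarrow> left_minor g I \<in> \<real> \<and> 0 < Re (left_minor g I)}"

definition orbit :: "real^3 \<Rightarrow> (complex^3^3) set" where
  "orbit l = {g ** i_diag l ** matrix_inv g | g. g \<in> unitary_group}"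

definition orbit_pos :: "real^3 \<Rightarrow> (complex^3^3) set" where
  "orbit_pos l = {g ** i_diag l ** matrix_inv g | g. g \<in> unitary_pos}"

text \<open>
  The orbit is compact, so the closure in the space of all matrices is the closure
  in the orbit.
\<close>

definition orbit_nonneg :: "real^3 \<Rightarrow> (complex^3^3) set" where
  "orbit_nonneg l = closure (orbit_pos l)"

definition lie_bracket :: "complex^3^3 \<Rightarrow> complex^3^3 \<Rightarrow> complex^3^3" where
  "lie_bracket L X = L ** X - X ** L"

definition kappa :: "complex^3^3 \<Rightarrow> complex^3^3 \<Rightarrow> complex" where
  "kappa L M = 2 * of_nat CARD(3) * trace (L ** M) - 2 * trace L * trace M"

definition tangent_space :: "complex^3^3 \<Rightarrow> (complex^3^3) set" where
  "tangent_space L = {lie_bracket L X | X. X \<in> skew_hermitian}"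

text \<open>
  The form \<open>kappa\<close> is real-valued on skew-Hermitian matrices, so taking real parts
  only adjusts the type.
\<close>

definition induced_metric :: "complex^3^3 \<Rightarrow> complex^3^3 \<Rightarrow> real" where
  "induced_metric V W = - Re (kappa V W)"

definition height :: "complex^3^3 \<Rightarrow> complex^3^3 \<Rightarrow> real" where
  "height N M = Re (kappa M N)"

text \<open>
  \<open>V\<close> is the gradient at \<open>L\<close>, in the induced metric, of the restriction of \<open>H\<close> to the
  orbit through \<open>L\<close>.  The differential of the restriction is the restriction of the
  ambient differential \<open>D\<close> to the tangent space.
\<close>

definition is_induced_gradient ::
    "(complex^3^3 \<Rightarrow> real) \<Rightarrow> complex^3^3 \<Rightarrow> complex^3^3 \<Rightarrow> bool" where
  "is_induced_gradient H L V \<longleftrightarrow>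
     V \<in> tangent_space L \<and>
     (\<exists>D. (H has_derivative D) (at L) \<and> (\<forall>W\<in>tangent_space L. induced_metric V W = D W))"

definition gradient_trajectory ::
    "real^3 \<Rightarrow> complex^3^3 \<Rightarrow> (real \<Rightarrow> complex^3^3) \<Rightarrow> bool" where
  "gradient_trajectory l N L \<longleftrightarrow>
     (\<forall>t. L t \<in> orbit l \<and>
          (\<exists>V. is_induced_gradient (height N) (L t) V \<and> (L has_vector_derivative V) (at t)))"

definition weakly_preserves_positivity :: "real^3 \<Rightarrow> complex^3^3 \<Rightarrow> bool" where
  "weakly_preserves_positivity l N \<longleftrightarrow>
     (\<forall>L. gradient_trajectory l N L \<and> L 0 \<in> orbit_nonneg l \<longrightarrow>
          (\<forall>t\<ge>0. L t \<in> orbit_nonneg l))"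

definition strictly_preserves_positivity :: "real^3 \<Rightarrow> complex^3^3 \<Rightarrow> bool" where
  "strictly_preserves_positivity l N \<longleftrightarrow>
     (\<forall>L. gradient_trajectory l N L \<and> L 0 \<in> orbit_nonneg l \<longrightarrow>
          (\<forall>t>0. L t \<in> orbit_pos l))"

definition constant_flow :: "real^3 \<Rightarrow> complex^3^3 \<Rightarrow> bool" where
  "constant_flow l N \<longleftrightarrow> (\<forall>L. gradient_trajectory l N L \<longrightarrow> (\<forall>t. L t = L 0))"

end

theory Submission imports Defs begin

text \<open>
  The flow lifts to the unitary group: writing \<open>L = g ** i_diag l ** g\<^sup>*\<close>, the columns of \<open>g\<close> move
  by a cubic vector field, so trajectories exist by Picard iteration.  On the closure of the positive
  part, the entries \<open>x\<^sub>i cnj x\<^sub>j\<close> of the first spectral projection are nonnegative, and those of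
  the third one have the sign pattern \<open>(+, -, +)\<close>.  If such an entry vanishes at time 0, its
  derivative must have the right sign.  Evaluated at boundary flags \<open>(x, y)\<close> (first and third column),
  with \<open>T = \<i> N\<close>, \<open>a = l\<^sub>1 - l\<^sub>2\<close>, \<open>b = l\<^sub>2 - l\<^sub>3\<close>, this gives in turn:
  coordinate flags force \<open>T\<^sub>1\<^sub>2, T\<^sub>2\<^sub>3 \<ge> 0\<close> and \<open>T\<^sub>1\<^sub>3 = 0\<close>; the flags with
  \<open>x = e\<^sub>2\<close> and \<open>y = (p, 0, q)\<close>, or \<open>y = - e\<^sub>2\<close> and \<open>x = (p, 0, q)\<close>, force
  \<open>T\<^sub>1\<^sub>2 = T\<^sub>2\<^sub>3 = 0\<close> unless \<open>2 * sqrt (a * (a + b)) \<ge> b\<close> and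
  \<open>2 * sqrt (b * (a + b)) \<ge> a\<close>, which is the condition on the ratio; and flags
  such as \<open>x = (0, 1, 1)\<close>, \<open>y = (1, -1, 1)\<close> then compare the diagonal entries.
\<close>

section \<open>Global solutions of Lipschitz differential equations\<close>

lemma integral_has_vector_derivative_atLeast:
  fixes h :: "real \<Rightarrow> 'a::banach"
  assumes "continuous_on UNIV h" "t \<ge> 0"
  shows "((\<lambda>u. integral {0..u} h) has_vector_derivative h t) (at t within {0..})"
proof -
  have "((\<lambda>u. integral {0..u} h) has_vector_derivative h t) (at t within {0..t+1})"
    using assms by (intro integral_has_vector_derivative continuous_on_subset[OF assms(1)]) auto
  moreover have "at t within {0..t+1} = at t within {0..}"
    by (rule at_within_nhd[where S = "{..<t+1}"]) auto
  ultimately show ?thesis by simp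
qed

text \<open>
  The weight \<open>exp (-2 K t)\<close> makes the Picard operator a contraction on the whole half-line at once.
\<close>

lemma picard_atLeast:
  fixes f :: "'a::euclidean_space \<Rightarrow> 'a"
  assumes K: "K > 0" and lip: "\<And>x y. norm (f x - f y) \<le> K * norm (x - y)"
    and bd: "\<And>x. norm (f x) \<le> B"
  shows "\<exists>x. x 0 = x0 \<and> (\<forall>t\<ge>0. (x has_vector_derivative f (x t)) (at t within {0..}))"
proof -
  define c where "c = 2 * K"
  have c: "c > 0" using K by (simp add: c_def)
  have B: "B \<ge> 0" using bd[of 0] norm_ge_zero order_trans by blast
  have contf: "continuous_on UNIV f"
    by (rule lipschitz_on_continuous_on[of K]) (use K lip in \<open>auto intro!: lipschitz_onI simp: dist_norm\<close>)
  \<comment> \<open>The unknown \<open>u\<close> stands for the weighted deviation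
    \<open>exp (- c * t) *\<^sub>R (x t - x0)\<close> of a solution \<open>x\<close>;
    \<open>P\<close> below is the Picard operator in this variable.\<close>
  define h where "h u s = f (x0 + exp (c * s) *\<^sub>R apply_bcontfun u s)" for u s
  have conth: "continuous_on UNIV (h u)" for u
    unfolding h_def
    by (rule continuous_on_compose2[OF contf]) (auto intro!: continuous_intros)
  have inth: "h u integrable_on {0..t}" for u t
    by (rule integrable_continuous_real[OF continuous_on_subset[OF conth]]) auto
  define P where "P u t = exp (- c * t) *\<^sub>R integral {0..t} (h u)" for u t
  \<comment> \<open>For \<open>t < 0\<close> the integral runs over an empty interval and is 0, so
    \<open>P u\<close> is a function on the whole line, as elements of \<open>bcontfun\<close> have
    to be.\<close>
  have P_neg: "P u t = 0" if "t \<le> 0" for u t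
    using that unfolding P_def by (cases "t = 0") auto
  have "continuous_on {0..} (\<lambda>t. integral {0..t} (h u))" for u
    unfolding continuous_on_eq_continuous_within
    using integral_has_vector_derivative_atLeast[OF conth]
    by (auto intro: has_vector_derivative_continuous)
  then have cont1: "continuous_on {0..} (P u)" for u
    unfolding P_def by (intro continuous_intros)
  have cont2: "continuous_on {..0} (P u)" for u
    by (rule continuous_on_eq[of _ "\<lambda>_. 0"]) (auto simp: P_neg)
  have contP: "continuous_on UNIV (P u)" for u
  proof -
    have "{0..} \<union> {..0::real} = UNIV" by auto
    then show ?thesis using continuous_on_closed_Un[OF _ _ cont1 cont2, of u] by simp
  qed
  \<comment> \<open>The integral grows at most like \<open>B * t\<close>, and the weight absorbs
    this because \<open>c * t \<le> exp (c * t)\<close>.\<close>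
  have bdP: "norm (P u t) \<le> B / c" for u t
  proof (cases "t \<ge> 0")
    case True
    have "norm (integral {0..t} (h u)) \<le> B * t"
      using integral_bound[of 0 t "h u" B] True bd conth[of u]
      by (auto simp: h_def intro: continuous_on_subset)
    then have "norm (P u t) \<le> exp (- c * t) * (B * t)"
      by (simp add: P_def mult_left_mono)
    then have "norm (P u t) \<le> B / c * (exp (- c * t) * (c * t))" using c by (simp add: mult_ac)
    moreover have "exp (- c * t) * (c * t) \<le> 1"
    proof -
      have "exp (- c * t) * (c * t) \<le> exp (- c * t) * exp (c * t)"
        by (intro mult_left_mono less_imp_le[OF exp_gt_self]) auto
      then show ?thesis by (simp flip: exp_add)
    qed
    then have "B / c * (exp (- c * t) * (c * t)) \<le> B / c * 1"
      using B c by (intro mult_left_mono) auto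
    ultimately show ?thesis by simp
  next
    case False
    then show ?thesis using P_neg[of t u] B c by simp
  qed
  have "P u \<in> bcontfun" for u
    by (rule bcontfun_normI[OF contP bdP])
  then have app: "apply_bcontfun (Bcontfun (P u)) = P u" for u
    by (simp add: Bcontfun_inverse)
  \<comment> \<open>Integrating the Lipschitz bound \<open>K * exp (c * s)\<close> gives at most
    \<open>K / c * exp (c * t)\<close>; with \<open>c = 2 * K\<close> the weight leaves the factor
    1/2.\<close>
  have contr: "dist (Bcontfun (P u)) (Bcontfun (P v)) \<le> 1/2 * dist u v" for u v
  proof (rule dist_bound, unfold app)
    fix t
    show "dist (P u t) (P v t) \<le> 1/2 * dist u v"
    proof (cases "t \<ge> 0")
      case True
      let ?d = "dist u v"
      have I: "((\<lambda>s. K * ?d * exp (c * s)) has_integral (K * ?d * (exp (c * t) / c) - K * ?d * (exp (c * 0) / c))) {0..t}"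
        using c True
        by (intro fundamental_theorem_of_calculus)
           (auto intro!: derivative_eq_intros simp flip: has_real_derivative_iff_has_vector_derivative)
      have pt: "norm (h u s - h v s) \<le> K * ?d * exp (c * s)" for s
      proof -
        have "norm (h u s - h v s) \<le> K * norm (exp (c * s) *\<^sub>R (u s - v s))"
          unfolding h_def using lip[of "x0 + exp (c * s) *\<^sub>R u s" "x0 + exp (c * s) *\<^sub>R v s"]
          by (simp add: scaleR_diff_right)
        also have "\<dots> \<le> K * (exp (c * s) * ?d)"
          using K dist_bounded[of u s v] by (simp add: dist_norm)
        finally show ?thesis by (simp add: mult_ac)
      qed
      have "norm (integral {0..t} (h u) - integral {0..t} (h v)) = norm (integral {0..t} (\<lambda>s. h u s - h v s))"
        by (simp add: integral_diff inth)
      also have "\<dots> \<le> integral {0..t} (\<lambda>s. K * ?d * exp (c * s))"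
        by (rule integral_norm_bound_integral) (use I pt inth in \<open>auto intro!: integrable_diff\<close>)
      also have "\<dots> = K * ?d * (exp (c * t) / c) - K * ?d * (1 / c)"
        unfolding integral_unique [OF I] by simp
      also have "\<dots> \<le> ?d / 2 * exp (c * t)"
        using K by (simp add: c_def)
      finally have "norm (P u t - P v t) \<le> exp (- c * t) * (?d / 2 * exp (c * t))"
        unfolding P_def scaleR_diff_right[symmetric] by (simp add: mult_left_mono)
      also have "\<dots> = 1/2 * ?d" by (simp add: exp_minus)
      finally show ?thesis by (simp add: dist_norm)
    next
      case False
      then show ?thesis using P_neg by simp
    qed
  qed
  have "\<exists>!u. Bcontfun (P u) = u"
    by (rule banach_fix_type[of "1/2"]) (use contr in auto)
  then obtain u where "Bcontfun (P u) = u" by blast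
  with app[of u] have u: "apply_bcontfun u = P u" by simp
  define x where "x t = x0 + exp (c * t) *\<^sub>R u t" for t
  have x: "x t = x0 + integral {0..t} (h u)" for t
    by (simp add: x_def u P_def exp_minus)
  have hx: "h u t = f (x t)" for t by (simp add: h_def x_def)
  have "(x has_vector_derivative f (x t)) (at t within {0..})" if "t \<ge> 0" for t
    unfolding hx[symmetric]
    using integral_has_vector_derivative_atLeast[OF conth[of u] that]
    unfolding x[abs_def] by (auto intro!: derivative_eq_intros)
  moreover have "x 0 = x0" by (simp add: x)
  ultimately show ?thesis by blast
qed

text \<open>Backward in time the equation is the forward equation of \<open>- f\<close>. The two
  half-line solutions are glued at 0, where values and one-sided derivatives agree.\<close>

lemma picard_global:
  fixes f :: "'a::euclidean_space \<Rightarrow> 'a"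
  assumes K: "K > 0" and lip: "\<And>x y. norm (f x - f y) \<le> K * norm (x - y)"
    and bd: "\<And>x. norm (f x) \<le> B"
  shows "\<exists>x. x 0 = x0 \<and> (\<forall>t. (x has_vector_derivative f (x t)) (at t))"
proof -
  obtain y where y0: "y 0 = x0"
    and y: "\<And>t. t \<ge> 0 \<Longrightarrow> (y has_vector_derivative f (y t)) (at t within {0..})"
    using picard_atLeast[OF assms] by blast
  obtain z where z0: "z 0 = x0"
    and z: "\<And>t. t \<ge> 0 \<Longrightarrow> (z has_vector_derivative - f (z t)) (at t within {0..})"
    using picard_atLeast[of K "\<lambda>x. - f x" B x0] K lip bd by (force simp: norm_minus_commute)
  define x where "x t = (if t \<in> {0..} then y t else z (- t))" for t
  have z': "((\<lambda>t. z (- t)) has_vector_derivative f (z (- t))) (at t within {..0})" if "t \<le> 0" for t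
  proof -
    have "((\<lambda>t::real. - t) has_vector_derivative -1) (at t within {..0})"
      by (auto intro!: derivative_eq_intros)
    moreover have "(z has_vector_derivative - f (z (- t))) (at (- t) within uminus ` {..0})"
      using z[of "- t"] that by simp
    ultimately show ?thesis
      using vector_diff_chain_within[of uminus "-1" t "{..0}" z "- f (z (- t))"] by (simp add: o_def)
  qed
  have "(x has_vector_derivative (if t \<in> {0..} then f (y t) else f (z (- t)))) (at t within UNIV)" for t
    unfolding x_def[abs_def]
  proof (rule has_vector_derivative_If_within_closures[of t "{0..}" "{..<0}"])
    have cl: "closure {..<0::real} = {..0}" by (rule closure_lessThan)
    have [simp]: "{0..} \<union> (closure {0..} \<inter> closure {..<0::real}) = {0..}"
        "{..<0} \<union> (closure {0..} \<inter> closure {..<0::real}) = {..0}"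
        "{..<0} \<union> ({0..} \<inter> {..0::real}) = {..0}"
      by (auto simp: cl)
    show "(y has_vector_derivative f (y t)) (at t within {0..} \<union> (closure {0..} \<inter> closure {..<0}))"
      if "t \<in> {0..} \<union> (closure {0..} \<inter> closure {..<0})"
      using that y[of t] by simp
    show "((\<lambda>t. z (- t)) has_vector_derivative f (z (- t))) (at t within {..<0} \<union> (closure {0..} \<inter> closure {..<0}))"
      if "t \<in> {..<0} \<union> (closure {0..} \<inter> closure {..<0})"
      using that z'[of t] by simp
    show "y t = z (- t)" if "t \<in> closure {0..}" "t \<in> closure {..<0}"
      using that y0 z0 by (simp add: cl)
    show "f (y t) = f (z (- t))" if "t \<in> closure {0..}" "t \<in> closure {..<0}"
      using that y0 z0 by (simp add: cl)
  qed auto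
  then have "(x has_vector_derivative f (x t)) (at t)" for t
    by (simp add: x_def if_distrib)
  moreover have "x 0 = x0" by (simp add: x_def y0)
  ultimately show ?thesis by blast
qed

section \<open>The flow lifted to the unitary group\<close>

lemma ctranspose_mult: "ctranspose (A ** B) = ctranspose B ** ctranspose A"
  by (simp add: ctranspose_def matrix_matrix_mult_def vec_eq_iff mult.commute)

lemma ctranspose_ctranspose [simp]: "ctranspose (ctranspose A) = A"
  by (simp add: ctranspose_def vec_eq_iff)

lemma ctranspose_scaleR: "ctranspose (c *\<^sub>R A) = c *\<^sub>R ctranspose A"
  by (simp add: ctranspose_def vec_eq_iff)

lemma bounded_linear_ctranspose: "bounded_linear ctranspose"
  by (simp add: linear_conv_bounded_linear [symmetric] linear_iff ctranspose_def vec_eq_iff)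

lemma bounded_bilinear_matrix_mult: "bounded_bilinear ((**) :: complex^3^3 \<Rightarrow> complex^3^3 \<Rightarrow> complex^3^3)"
  by (simp add: bilinear_conv_bounded_bilinear [symmetric] bilinear_def linear_iff
      matrix_matrix_mult_def vec_eq_iff algebra_simps sum.distrib scaleR_sum_right)

lemmas matrix_mult_simps =
  bounded_bilinear.add_left [OF bounded_bilinear_matrix_mult]
  bounded_bilinear.add_right [OF bounded_bilinear_matrix_mult]
  bounded_bilinear.diff_left [OF bounded_bilinear_matrix_mult]
  bounded_bilinear.diff_right [OF bounded_bilinear_matrix_mult]
  bounded_bilinear.minus_left [OF bounded_bilinear_matrix_mult]
  bounded_bilinear.minus_right [OF bounded_bilinear_matrix_mult]
  bounded_bilinear.scaleR_left [OF bounded_bilinear_matrix_mult]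
  bounded_bilinear.scaleR_right [OF bounded_bilinear_matrix_mult]
  matrix_mul_assoc

lemma unitaryD:
  assumes "g \<in> unitary_group"
  shows "g ** ctranspose g = mat 1" "ctranspose g ** g = mat 1"
    "A ** g ** ctranspose g = A" "A ** ctranspose g ** g = A"
  using assms by (simp_all add: unitary_group_def flip: matrix_mul_assoc)

lemma unitary_groupI: "g ** ctranspose g = mat 1 \<Longrightarrow> g \<in> unitary_group"
  using matrix_left_right_inverse [of g "ctranspose g"] by (simp add: unitary_group_def)

lemma matrix_inv_unitary:
  assumes "g \<in> unitary_group"
  shows "matrix_inv g = ctranspose g"
proof -
  have inv: "g ** matrix_inv g = mat 1 \<and> matrix_inv g ** g = mat 1"
    unfolding matrix_inv_def by (rule someI [of _ "ctranspose g"]) (use assms in \<open>simp add: unitaryD\<close>)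
  have "matrix_inv g = matrix_inv g ** (g ** ctranspose g)"
    using assms by (simp add: unitaryD)
  also have "\<dots> = ctranspose g" using inv by (simp add: matrix_mul_assoc)
  finally show ?thesis .
qed

section \<open>The orbit and the bracket with a diagonal matrix\<close>

lemma ctranspose_i_diag: "ctranspose (i_diag l) = - i_diag l"
  by (simp add: ctranspose_def i_diag_def vec_eq_iff)

lemma orbit_eq: "orbit l = (\<lambda>g. g ** i_diag l ** ctranspose g) ` unitary_group"
  unfolding orbit_def Setcompr_eq_image
  by (rule image_cong) (simp_all add: matrix_inv_unitary)

lemma orbit_pos_eq: "orbit_pos l = (\<lambda>g. g ** i_diag l ** ctranspose g) ` unitary_pos"
  unfolding orbit_pos_def Setcompr_eq_image
  by (rule image_cong) (auto simp: matrix_inv_unitary unitary_pos_def)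

lemma orbit_skew_hermitian: "L \<in> orbit l \<Longrightarrow> L \<in> skew_hermitian"
  by (auto simp: orbit_eq skew_hermitian_def ctranspose_mult ctranspose_i_diag matrix_mult_simps)

text \<open>For distinct entries of \<open>l\<close>, the inverse of
  \<open>lie_bracket (i_diag l)\<close> on matrices with zero diagonal.\<close>

definition ad_diag_inv :: "real^3 \<Rightarrow> complex^3^3 \<Rightarrow> complex^3^3" where
  "ad_diag_inv l M = (\<chi> i j. if i = j then 0 else M $ i $ j / (\<i> * complex_of_real (l $ i - l $ j)))"

definition diag_part :: "complex^3^3 \<Rightarrow> complex^3^3" where
  "diag_part M = (\<chi> i j. if i = j then M $ i $ j else 0)"

lemma bounded_linear_ad_diag_inv: "bounded_linear (ad_diag_inv l)"
  by (simp add: linear_conv_bounded_linear [symmetric] linear_iff ad_diag_inv_def vec_eq_iff add_divide_distrib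
      scaleR_conv_of_real)

text \<open>The denominators \<open>\<i> * (l $ i - l $ j)\<close> form a Hermitian array, so the
  division respects skew-Hermitian symmetry. This keeps the motion with velocity
  \<open>g ** ad_diag_inv l M\<close> on the unitary group.\<close>

lemma ctranspose_ad_diag_inv:
  assumes "M \<in> skew_hermitian"
  shows "ctranspose (ad_diag_inv l M) = - ad_diag_inv l M"
proof -
  have M: "cnj (M $ j $ i) = - M $ i $ j" for i j
    using assms by (simp add: skew_hermitian_def ctranspose_def vec_eq_iff)
  show ?thesis
    by (simp add: ctranspose_def ad_diag_inv_def vec_eq_iff M complex_cnj_divide divide_simps)
       (auto simp: algebra_simps)
qed

lemma mult_i_diag_nth:
  "(M ** i_diag l) $ i $ j = M $ i $ j * (\<i> * complex_of_real (l $ j))"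
  "(i_diag l ** M) $ i $ j = \<i> * complex_of_real (l $ i) * M $ i $ j"
  by (simp_all add: i_diag_def matrix_matrix_mult_def if_distrib [of "\<lambda>x. x * _"]
      if_distrib [of "\<lambda>x. _ * x"] cong: if_cong)

lemma diag_part_commutes: "diag_part M ** i_diag l = i_diag l ** diag_part M"
  by (simp add: diag_part_def vec_eq_iff mult_i_diag_nth)

text \<open>This splits \<open>M\<close> into its components in the kernel and the image of the
  bracket with \<open>i_diag l\<close>: off the diagonal, that bracket multiplies by the very
  factors that \<open>ad_diag_inv\<close> divides by.\<close>

lemma bracket_ad_diag_inv:
  assumes "\<And>i j. i \<noteq> j \<Longrightarrow> l $ i \<noteq> l $ j"
  shows "ad_diag_inv l M ** i_diag l - i_diag l ** ad_diag_inv l M = diag_part M - M"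
proof -
  have "(ad_diag_inv l M ** i_diag l - i_diag l ** ad_diag_inv l M) $ i $ j = (diag_part M - M) $ i $ j" for i j
  proof (cases "i = j")
    case True
    then show ?thesis by (simp add: diag_part_def ad_diag_inv_def mult_i_diag_nth)
  next
    case False
    define d where "d = \<i> * complex_of_real (l $ i - l $ j)"
    define q where "q = M $ i $ j / d"
    have "d \<noteq> 0" using assms [OF False] by (simp add: d_def)
    have "(ad_diag_inv l M ** i_diag l - i_diag l ** ad_diag_inv l M) $ i $ j
        = q * (\<i> * complex_of_real (l $ j)) - \<i> * complex_of_real (l $ i) * q"
      using False by (simp add: ad_diag_inv_def mult_i_diag_nth d_def q_def)
    also have "\<dots> = - (q * d)" by (simp add: d_def algebra_simps)
    also have "\<dots> = (diag_part M - M) $ i $ j"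
      using False \<open>d \<noteq> 0\<close> by (simp add: diag_part_def q_def)
    finally show ?thesis .
  qed
  then show ?thesis by (simp add: vec_eq_iff)
qed

text \<open>Change one factor at a time; the other is bounded by compactness. Repeated use makes the
  cubic field Lipschitz on a ball.\<close>

lemma lipschitz_on_bounded_bilinear:
  assumes h: "bounded_bilinear h" and S: "compact S" and f: "C-lipschitz_on S f" and g: "D-lipschitz_on S g"
  shows "\<exists>E. E-lipschitz_on S (\<lambda>x. h (f x) (g x))"
proof -
  obtain K where K: "K > 0" "\<And>a b. norm (h a b) \<le> norm a * norm b * K"
    using bounded_bilinear.pos_bounded [OF h] by blast
  obtain a where a: "a > 0" "\<And>x. x \<in> S \<Longrightarrow> norm (f x) \<le> a"
    using compact_imp_bounded [OF compact_continuous_image [OF lipschitz_on_continuous_on [OF f] S]]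
    by (auto simp: bounded_pos)
  obtain b where b: "b > 0" "\<And>x. x \<in> S \<Longrightarrow> norm (g x) \<le> b"
    using compact_imp_bounded [OF compact_continuous_image [OF lipschitz_on_continuous_on [OF g] S]]
    by (auto simp: bounded_pos)
  have "(a * D * K + C * b * K)-lipschitz_on S (\<lambda>x. h (f x) (g x))"
  proof (rule lipschitz_onI)
    fix x y assume xy: "x \<in> S" "y \<in> S"
    have "h (f x) (g x) - h (f y) (g y) = h (f x) (g x - g y) + h (f x - f y) (g y)"
      by (simp add: bounded_bilinear.diff_left [OF h] bounded_bilinear.diff_right [OF h])
    then have "norm (h (f x) (g x) - h (f y) (g y))
        \<le> norm (f x) * norm (g x - g y) * K + norm (f x - f y) * norm (g y) * K"
      by (metis K(2) add_mono norm_triangle_le)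
    also have "\<dots> \<le> a * (D * dist x y) * K + (C * dist x y) * b * K"
      using K(1) a b xy lipschitz_onD [OF f xy] lipschitz_onD [OF g xy]
        lipschitz_on_nonneg [OF f] lipschitz_on_nonneg [OF g]
      by (intro add_mono mult_right_mono mult_mono) (auto simp: dist_norm)
    finally show "dist (h (f x) (g x)) (h (f y) (g y)) \<le> (a * D * K + C * b * K) * dist x y"
      by (simp add: dist_norm algebra_simps)
  qed (use a b K lipschitz_on_nonneg [OF f] lipschitz_on_nonneg [OF g] in auto)
  then show ?thesis by blast
qed

text \<open>The factor is 1 inside the ball and \<open>R / norm a\<close> outside.\<close>

lemma closest_point_cball_zero:
  fixes a :: "'a::euclidean_space"
  assumes "R > 0"
  shows "\<exists>k. closest_point (cball 0 R) a = k *\<^sub>R a"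
proof (cases "norm a \<le> R")
  case True
  then have "closest_point (cball 0 R) a = 1 *\<^sub>R a" by (simp add: closest_point_self)
  then show ?thesis by blast
next
  case False
  then have a: "a \<noteq> 0" using assms by auto
  let ?x = "(R / norm a) *\<^sub>R a"
  have "a - ?x = ((norm a - R) / norm a) *\<^sub>R a"
    using a by (simp add: diff_divide_distrib scaleR_diff_left)
  then have d: "dist a ?x = norm a - R"
    using False a by (simp add: dist_norm)
  have "?x = closest_point (cball 0 R) a"
  proof (rule closest_point_unique)
    show "?x \<in> cball 0 R" using False assms by (auto simp: norm_divide)
    show "\<forall>z\<in>cball 0 R. dist a ?x \<le> dist a z"
    proof
      fix z :: 'a assume "z \<in> cball 0 R"
      then show "dist a ?x \<le> dist a z"
        unfolding d using norm_triangle_ineq2 [of a z] by (simp add: dist_norm)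
    qed
  qed auto
  then show ?thesis by metis
qed

lemma norm_matrix_sq: "(norm (A :: complex^3^3))\<^sup>2 = (\<Sum>i\<in>UNIV. \<Sum>j\<in>UNIV. (cmod (A $ i $ j))\<^sup>2)"
  by (simp add: norm_vec_def L2_set_def sum_nonneg)

text \<open>Each of the three rows has length 1, so the squared norm is 3. Hence the ball of radius
  2 used for the truncation contains the unitary group.\<close>

lemma norm_unitary_le:
  assumes "g ** ctranspose g = mat 1"
  shows "norm g \<le> 2"
proof -
  have "(\<Sum>j\<in>UNIV. (cmod (g $ i $ j))\<^sup>2) = 1" for i
  proof -
    have "complex_of_real (\<Sum>j\<in>UNIV. (cmod (g $ i $ j))\<^sup>2) = (g ** ctranspose g) $ i $ i"
      by (simp add: matrix_matrix_mult_def ctranspose_def complex_norm_square del: of_real_power)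
    also have "\<dots> = 1" by (simp add: assms mat_def)
    finally show ?thesis using of_real_eq_1_iff by blast
  qed
  then have "(norm g)\<^sup>2 \<le> 2\<^sup>2" by (simp add: norm_matrix_sq)
  then show ?thesis by (rule power2_le_imp_le) simp
qed

lemma skew_hermitian_conj:
  assumes "N \<in> skew_hermitian"
  shows "ctranspose g ** N ** g \<in> skew_hermitian"
  using assms by (simp add: skew_hermitian_def ctranspose_mult matrix_mult_simps)

text \<open>
  The field is cubic in \<open>g\<close>, so it is evaluated at the projection of \<open>g\<close> to a ball.  Since
  that projection is a real multiple of \<open>g\<close>, the product \<open>g ** ctranspose g\<close> is still conserved,
  and the solution never leaves the ball.
\<close>

lemma unitary_flow_exists:
  assumes N: "N \<in> skew_hermitian" and g0: "g0 \<in> unitary_group"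
  shows "\<exists>g. g 0 = g0 \<and> (\<forall>t. g t \<in> unitary_group \<and>
    (g has_vector_derivative g t ** ad_diag_inv l (ctranspose (g t) ** N ** g t)) (at t))"
proof -
  let ?B = "cball 0 2 :: (complex^3^3) set"
  define A where "A g = ad_diag_inv l (ctranspose g ** N ** g)" for g
  define \<rho> where "\<rho> g = closest_point ?B g" for g
  note bilip = lipschitz_on_bounded_bilinear [OF bounded_bilinear_matrix_mult compact_cball]
  obtain c1 where "c1-lipschitz_on ?B ctranspose"
    using bounded_linear.lipschitz_boundE [OF bounded_linear_ctranspose] by blast
  then obtain c2 where "c2-lipschitz_on ?B (\<lambda>g. ctranspose g ** N)"
    using bilip lipschitz_on_constant by blast
  then obtain c3 where c3: "c3-lipschitz_on ?B (\<lambda>g. ctranspose g ** N ** g)"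
    using bilip lipschitz_on_id by blast
  obtain c4 where c4: "c4-lipschitz_on UNIV (ad_diag_inv l)"
    using bounded_linear.lipschitz_boundE [OF bounded_linear_ad_diag_inv] by blast
  have "(c4 * c3)-lipschitz_on ?B A"
    unfolding A_def by (rule lipschitz_on_compose2 [OF c3]) (rule lipschitz_on_subset [OF c4], simp)
  then obtain c5 where c5: "c5-lipschitz_on ?B (\<lambda>g. g ** A g)"
    using bilip lipschitz_on_id by blast
  have \<rho>_mem: "\<rho> g \<in> ?B" for g
    unfolding \<rho>_def by (rule closest_point_in_set) auto
  have lip: "norm (\<rho> x ** A (\<rho> x) - \<rho> y ** A (\<rho> y)) \<le> (c5 + 1) * norm (x - y)" for x y
  proof -
    have "norm (\<rho> x ** A (\<rho> x) - \<rho> y ** A (\<rho> y)) \<le> c5 * dist (\<rho> x) (\<rho> y)"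
      using lipschitz_onD [OF c5 \<rho>_mem \<rho>_mem] by (simp add: dist_norm)
    also have "\<dots> \<le> c5 * dist x y"
      unfolding \<rho>_def using lipschitz_on_nonneg [OF c5]
      by (intro mult_left_mono closest_point_lipschitz) auto
    also have "\<dots> \<le> (c5 + 1) * norm (x - y)" by (simp add: dist_norm algebra_simps)
    finally show ?thesis .
  qed
  have "bounded ((\<lambda>g. g ** A g) ` ?B)"
    by (intro compact_imp_bounded compact_continuous_image lipschitz_on_continuous_on [OF c5] compact_cball)
  then obtain B where B: "\<And>g. g \<in> ?B \<Longrightarrow> norm (g ** A g) \<le> B"
    unfolding bounded_iff by (metis imageI)
  obtain g where g0': "g 0 = g0"
    and g: "\<And>t. (g has_vector_derivative \<rho> (g t) ** A (\<rho> (g t))) (at t)"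
    using picard_global [of "c5 + 1" "\<lambda>g. \<rho> g ** A (\<rho> g)" B g0] lip B \<rho>_mem lipschitz_on_nonneg [OF c5]
    by (metis add_nonneg_pos zero_less_one)
  have "((\<lambda>t. g t ** ctranspose (g t)) has_vector_derivative 0) (at t)" for t
  proof -
    obtain k where k: "\<rho> (g t) = k *\<^sub>R g t"
      unfolding \<rho>_def using closest_point_cball_zero [of 2 "g t"] by auto
    let ?A = "A (\<rho> (g t))"
    have sk: "ctranspose ?A = - ?A"
      unfolding A_def by (intro ctranspose_ad_diag_inv skew_hermitian_conj N)
    have "((\<lambda>t. ctranspose (g t)) has_vector_derivative ctranspose (\<rho> (g t) ** ?A)) (at t)"
      by (rule bounded_linear.has_vector_derivative [OF bounded_linear_ctranspose g])
    from bounded_bilinear.has_vector_derivative [OF bounded_bilinear_matrix_mult g this]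
    have "((\<lambda>t. g t ** ctranspose (g t)) has_vector_derivative
        g t ** ctranspose (\<rho> (g t) ** ?A) + \<rho> (g t) ** ?A ** ctranspose (g t)) (at t)" .
    also have "g t ** ctranspose (\<rho> (g t) ** ?A) + \<rho> (g t) ** ?A ** ctranspose (g t) = 0"
      unfolding ctranspose_mult sk unfolding k by (simp add: ctranspose_scaleR matrix_mult_simps)
    finally show ?thesis .
  qed
  then obtain c where c: "\<And>t. g t ** ctranspose (g t) = c"
    using has_vector_derivative_zero_constant [of UNIV "\<lambda>t. g t ** ctranspose (g t)"] by auto
  have gg: "g t ** ctranspose (g t) = mat 1" for t
    using c [of t] c [of 0] g0 g0' by (simp add: unitaryD)
  have "\<rho> (g t) = g t" for t
    unfolding \<rho>_def using norm_unitary_le [OF gg] by (intro closest_point_self) simp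
  then show ?thesis
    using g g0' unitary_groupI [OF gg] unfolding A_def by metis
qed

section \<open>Gradient trajectories\<close>

lemma trace_lie_bracket: "trace (lie_bracket A B) = 0"
  by (simp add: lie_bracket_def trace_sub trace_mul_sym [of A B])

text \<open>Image and kernel of the bracket with \<open>L\<close> are orthogonal for the trace form,
  by cyclicity of the trace.\<close>

lemma trace_lie_bracket_mult_eq_zero:
  assumes "Z ** L = L ** Z"
  shows "trace (lie_bracket L Y ** Z) = 0"
proof -
  have "trace (lie_bracket L Y ** Z) = trace (L ** (Y ** Z)) - trace (Y ** (L ** Z))"
    by (simp add: lie_bracket_def matrix_mult_simps trace_sub)
  also have "trace (L ** (Y ** Z)) = trace (Y ** Z ** L)" by (rule trace_mul_sym)
  also have "Y ** Z ** L = Y ** (L ** Z)" by (simp add: assms flip: matrix_mul_assoc)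
  finally show ?thesis by simp
qed

lemma bounded_linear_height: "bounded_linear (height N)"
  by (simp add: linear_conv_bounded_linear [symmetric] linear_iff height_def kappa_def trace_def
      matrix_mult_simps sum.distrib algebra_simps scaleR_sum_right [symmetric])

text \<open>The lifted velocity: for unitary \<open>g\<close> and distinct entries of
  \<open>l\<close>, conjugating \<open>i_diag l\<close> turns it into minus the component of
  \<open>N\<close> in the image of the bracket with \<open>L\<close>.\<close>

definition orbit_field :: "real^3 \<Rightarrow> complex^3^3 \<Rightarrow> complex^3^3 \<Rightarrow> complex^3^3" where
  "orbit_field l N g = g ** ad_diag_inv l (ctranspose g ** N ** g)"

text \<open>The sum \<open>?V + N\<close> is a conjugated diagonal matrix, so it commutes with
  \<open>?L\<close> and is trace-orthogonal to all tangent vectors. Brackets are traceless, so only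
  the term \<open>trace (L ** M)\<close> of \<open>kappa\<close> survives.\<close>

lemma is_induced_gradient_orbit_field:
  assumes inj: "\<And>i j. i \<noteq> j \<Longrightarrow> l $ i \<noteq> l $ j"
    and N: "N \<in> skew_hermitian" and g: "g \<in> unitary_group"
  shows "is_induced_gradient (height N) (g ** i_diag l ** ctranspose g)
    (g ** i_diag l ** ctranspose (orbit_field l N g) + orbit_field l N g ** i_diag l ** ctranspose g)"
    (is "is_induced_gradient _ ?L ?V")
proof -
  define M where "M = ctranspose g ** N ** g"
  define A where "A = ad_diag_inv l M"
  have A: "ctranspose A = - A"
    unfolding A_def M_def by (intro ctranspose_ad_diag_inv skew_hermitian_conj N)
  have V: "?V = g ** (A ** i_diag l - i_diag l ** A) ** ctranspose g"
    by (simp add: orbit_field_def A matrix_mult_simps ctranspose_mult flip: A_def M_def)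
  have X: "?V = lie_bracket ?L (- (g ** A ** ctranspose g))"
    unfolding V by (simp add: lie_bracket_def matrix_mult_simps unitaryD [OF g])
  have "- (g ** A ** ctranspose g) \<in> skew_hermitian"
    using linear_neg [OF bounded_linear.linear [OF bounded_linear_ctranspose]]
    by (simp add: skew_hermitian_def ctranspose_mult A matrix_mult_simps)
  with X have "?V \<in> tangent_space ?L" unfolding tangent_space_def by blast
  moreover have "(height N has_derivative height N) (at ?L)"
    by (rule bounded_linear_imp_has_derivative [OF bounded_linear_height])
  moreover have "induced_metric ?V W = height N W" if "W \<in> tangent_space ?L" for W
  proof -
    from that obtain Y where W: "W = lie_bracket ?L Y" unfolding tangent_space_def by blast
    have br: "A ** i_diag l - i_diag l ** A = diag_part M - M"
      unfolding A_def by (rule bracket_ad_diag_inv) (rule inj)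
    have "?V + N = g ** diag_part M ** ctranspose g"
      unfolding V br M_def by (simp add: matrix_mult_simps unitaryD [OF g])
    then have "(?V + N) ** ?L = ?L ** (?V + N)"
      using arg_cong [OF diag_part_commutes [of M l], of "\<lambda>X. g ** X ** ctranspose g"]
      by (simp add: matrix_mult_simps unitaryD [OF g])
    then have "trace (W ** (?V + N)) = 0"
      unfolding W by (rule trace_lie_bracket_mult_eq_zero)
    then have "trace (?V ** W) = - trace (W ** N)"
      unfolding trace_mul_sym [of ?V] matrix_add_ldistrib trace_add by (simp add: add_eq_0_iff)
    moreover have "trace ?V = 0" "trace W = 0"
      unfolding X W by (rule trace_lie_bracket)+
    ultimately show ?thesis by (simp add: induced_metric_def height_def kappa_def)
  qed
  ultimately show ?thesis unfolding is_induced_gradient_def by blast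
qed

lemma orbit_flow_exists:
  assumes inj: "\<And>i j. i \<noteq> j \<Longrightarrow> l $ i \<noteq> l $ j"
    and N: "N \<in> skew_hermitian" and g0: "g0 \<in> unitary_group"
  obtains g where "g 0 = g0" "\<And>t. g t \<in> unitary_group"
    "\<And>t. (g has_vector_derivative orbit_field l N (g t)) (at t)"
    "gradient_trajectory l N (\<lambda>t. g t ** i_diag l ** ctranspose (g t))"
proof -
  obtain g where g: "g 0 = g0" "\<And>t. g t \<in> unitary_group"
    and d: "\<And>t. (g has_vector_derivative orbit_field l N (g t)) (at t)"
    using unitary_flow_exists [OF N g0, of l] unfolding orbit_field_def by blast
  note mult = bounded_bilinear.has_vector_derivative [OF bounded_bilinear_matrix_mult]
  have "((\<lambda>t. g t ** i_diag l) has_vector_derivative orbit_field l N (g t) ** i_diag l) (at t)" for t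
    using mult [OF d [of t] has_vector_derivative_const [of "i_diag l"]] by simp
  from mult [OF this bounded_linear.has_vector_derivative [OF bounded_linear_ctranspose d]]
  have "gradient_trajectory l N (\<lambda>t. g t ** i_diag l ** ctranspose (g t))"
    unfolding gradient_trajectory_def orbit_eq using g is_induced_gradient_orbit_field [OF inj N] by blast
  with g d that show thesis by blast
qed

lemma orbit_trajectory_exists:
  assumes "\<And>i j. i \<noteq> j \<Longrightarrow> l $ i \<noteq> l $ j" "N \<in> skew_hermitian" "L0 \<in> orbit l"
  obtains L where "gradient_trajectory l N L" "L 0 = L0"
proof -
  obtain g0 where g0: "g0 \<in> unitary_group" "L0 = g0 ** i_diag l ** ctranspose g0"
    using assms(3) by (auto simp: orbit_eq)
  obtain g where "g 0 = g0" "gradient_trajectory l N (\<lambda>t. g t ** i_diag l ** ctranspose (g t))"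
    using orbit_flow_exists [OF assms(1,2) g0(1)] by blast
  with g0 that show thesis by blast
qed

section \<open>Definiteness of the metric, and the flow of scalar matrices\<close>

lemma lie_bracket_skew_hermitian:
  assumes "X \<in> skew_hermitian" "Y \<in> skew_hermitian"
  shows "lie_bracket X Y \<in> skew_hermitian"
  using assms linear_diff [OF bounded_linear.linear [OF bounded_linear_ctranspose]]
  by (simp add: skew_hermitian_def lie_bracket_def ctranspose_mult matrix_mult_simps)

text \<open>Skew-Hermitian symmetry makes \<open>trace (V ** V)\<close> minus the squared Frobenius
  norm. The lemma serves to show that a tangent vector of metric length 0 is 0.\<close>

lemma induced_metric_self:
  assumes "V \<in> skew_hermitian" "trace V = 0"
  shows "induced_metric V V = 6 * (norm V)\<^sup>2"
proof -
  have V: "V $ i $ j = - cnj (V $ j $ i)" for i j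
  proof -
    have "cnj (V $ j $ i) = ctranspose V $ i $ j" by (simp add: ctranspose_def)
    also have "\<dots> = - V $ i $ j" using assms(1) by (simp add: skew_hermitian_def)
    finally show ?thesis by simp
  qed
  have "V $ i $ j * V $ j $ i = - complex_of_real ((cmod (V $ i $ j))\<^sup>2)" for i j
    unfolding complex_norm_square by (subst V [of j i]) simp
  then have "trace (V ** V) = - complex_of_real (\<Sum>i\<in>UNIV. \<Sum>j\<in>UNIV. (cmod (V $ i $ j))\<^sup>2)"
    by (simp add: trace_def matrix_matrix_mult_def sum_negf del: of_real_power)
  then show ?thesis
    using assms(2) by (simp add: induced_metric_def kappa_def norm_matrix_sq)
qed

text \<open>The two terms of \<open>kappa\<close> cancel, because \<open>trace (mat c)\<close> is
  \<open>3 * c\<close>.\<close>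

lemma height_scalar: "height (mat c) W = 0"
proof -
  have "W ** mat c = (\<chi> i j. W $ i $ j * c)"
    by (simp add: matrix_matrix_mult_def mat_def vec_eq_iff if_distrib cong: if_cong)
  then show ?thesis
    by (simp add: height_def kappa_def trace_def mat_def sum_3 algebra_simps)
qed

text \<open>The height is identically 0, so each velocity is a tangent vector of metric length 0 and
  vanishes.\<close>

lemma scalar_constant_flow: "constant_flow l (mat c)"
  unfolding constant_flow_def
proof (intro allI impI)
  fix L t assume L: "gradient_trajectory l (mat c) L"
  have "(L has_vector_derivative 0) (at t)" for t
  proof -
    obtain V D where V: "V \<in> tangent_space (L t)" and dL: "(L has_vector_derivative V) (at t)"
      and D: "(height (mat c) has_derivative D) (at (L t))"
        "\<And>W. W \<in> tangent_space (L t) \<Longrightarrow> induced_metric V W = D W"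
      using L unfolding gradient_trajectory_def is_induced_gradient_def by meson
    have Lt: "L t \<in> skew_hermitian"
      using L orbit_skew_hermitian unfolding gradient_trajectory_def by blast
    have "height (mat c) = (\<lambda>_. 0)" by (simp add: fun_eq_iff height_scalar)
    then have "D = (\<lambda>_. 0)"
      using D(1) has_derivative_unique has_derivative_const by metis
    then have "induced_metric V V = 0" using D(2) [OF V] by simp
    moreover have "V \<in> skew_hermitian" "trace V = 0"
      using V lie_bracket_skew_hermitian [OF Lt] trace_lie_bracket by (auto simp: tangent_space_def)
    ultimately have "V = 0" using induced_metric_self by simp
    then show ?thesis using dL by simp
  qed
  then show "L t = L 0"
    using has_vector_derivative_zero_constant [of UNIV L] by (metis UNIV_I convex_UNIV)
qed

section \<open>Positive and nonnegative frames\<close>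

lemma left_minor_1: "left_minor A {i} = A $ of_nat i $ 1"
  by (simp add: left_minor_def permutes_sing lessThan_Suc)

lemma left_minor_2:
  assumes "i < j"
  shows "left_minor A {i, j} = A $ of_nat i $ 1 * A $ of_nat j $ 2 - A $ of_nat i $ 2 * A $ of_nat j $ 1"
proof -
  have s: "sorted_list_of_set {i, j} = [i, j]" and c: "card {i, j} = 2" and l: "{..<2::nat} = {0, 1}"
    using assms by (auto simp: insort_is_Cons)
  have f: "finite {1::nat}" "0 \<notin> {1::nat}" by auto
  show ?thesis
    unfolding left_minor_def s c l sum_over_permutations_insert [OF f] permutes_sing
    by (simp add: sign_swap_id sign_id swap_id_eq)
qed

lemma left_minor_3: "left_minor A {1, 2, 3} = det A"
proof -
  have s: "sorted_list_of_set {1, 2, 3} = [1, 2, 3::nat]" and c: "card {1, 2, 3::nat} = 3"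
    and l: "{..<3::nat} = {0, 1, 2}"
    by (auto simp: insort_is_Cons)
  have f12: "finite {1, 2::nat}" "0 \<notin> {1, 2::nat}" by auto
  have f2: "finite {2::nat}" "1 \<notin> {2::nat}" by auto
  show ?thesis
    unfolding left_minor_def s c l sum_over_permutations_insert [OF f12] sum_over_permutations_insert [OF f2]
      permutes_sing det_3
    by (simp add: sign_swap_id permutation_swap_id sign_compose sign_id swap_id_eq)
qed

lemma row_set_cases:
  assumes "I \<subseteq> {1..3::nat}" "I \<noteq> {}"
  shows "I \<in> {{1}, {2}, {3}, {1, 2}, {1, 3}, {2, 3}, {1, 2, 3}}"
proof -
  have "{1..3::nat} = {1, 2, 3}" by auto
  then have "I \<in> Pow {1, 2, 3}" using assms(1) by simp
  then show ?thesis using assms(2) by (simp add: Pow_insert) (elim disjE; simp)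
qed

text \<open>The signs with which the left-justified 2 by 2 minors enter the cofactors of the third
  column.\<close>

definition col3_sign :: "3 \<Rightarrow> real" where
  "col3_sign i = (if i = 2 then -1 else 1)"

text \<open>In the order on complex numbers, \<open>0 < z\<close> already says that \<open>z\<close>
  is real, so each pair of conditions on a minor becomes one inequality.\<close>

lemma unitary_pos_iff:
  "g \<in> unitary_pos \<longleftrightarrow> g \<in> unitary_group \<and>
     (\<forall>i. 0 < g $ i $ 1) \<and> 0 < det g \<and>
     0 < g $ 1 $ 1 * g $ 2 $ 2 - g $ 1 $ 2 * g $ 2 $ 1 \<and>
     0 < g $ 1 $ 1 * g $ 3 $ 2 - g $ 1 $ 2 * g $ 3 $ 1 \<and>
     0 < g $ 2 $ 1 * g $ 3 $ 2 - g $ 2 $ 2 * g $ 3 $ 1"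
proof -
  have pos: "z \<in> \<real> \<and> 0 < Re z \<longleftrightarrow> 0 < z" for z
    by (auto simp: less_complex_def complex_is_Real_iff)
  have "(\<forall>I. I \<subseteq> {1..3} \<and> I \<noteq> {} \<longrightarrow> left_minor g I \<in> \<real> \<and> 0 < Re (left_minor g I)) \<longleftrightarrow>
      (\<forall>I\<in>{{1}, {2}, {3}, {1, 2}, {1, 3}, {2, 3}, {1, 2, 3}}. 0 < left_minor g I)" (is "?L \<longleftrightarrow> ?R")
    unfolding pos
  proof
    assume "\<forall>I. I \<subseteq> {1..3} \<and> I \<noteq> {} \<longrightarrow> 0 < left_minor g I"
    then show ?R by auto
  next
    assume ?R
    then show "\<forall>I. I \<subseteq> {1..3} \<and> I \<noteq> {} \<longrightarrow> 0 < left_minor g I"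
      by (metis row_set_cases)
  qed
  then show ?thesis
    unfolding unitary_pos_def
    by (auto simp: left_minor_1 left_minor_2 left_minor_3 [simplified] forall_3)
qed

text \<open>A real flag is given by orthogonal vectors \<open>x\<close> and \<open>y\<close>, the
  directions of the first and third columns. The order of factors in \<open>cross3 y x\<close> makes
  the determinant 1.\<close>

definition frame_col :: "real^3 \<Rightarrow> real^3 \<Rightarrow> 3 \<Rightarrow> real^3" where
  "frame_col x y j = (if j = 1 then x /\<^sub>R norm x
     else if j = 2 then cross3 y x /\<^sub>R (norm x * norm y) else y /\<^sub>R norm y)"

definition frame :: "real^3 \<Rightarrow> real^3 \<Rightarrow> complex^3^3" where
  "frame x y = (\<chi> i j. complex_of_real (frame_col x y j $ i))"

lemma frame_unitary:
  assumes "x \<noteq> 0" "y \<noteq> 0" "x \<bullet> y = 0"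
  shows "frame x y \<in> unitary_group"
proof -
  have "(norm (cross3 y x))\<^sup>2 = (norm x * norm y)\<^sup>2"
    using norm_cross_dot [of y x] assms(3) by (simp add: inner_commute [of y x] mult.commute)
  then have n: "norm (cross3 y x) = norm x * norm y"
    by (rule power2_eq_imp_eq) auto
  have "frame_col x y i \<bullet> frame_col x y j = (if i = j then 1 else 0)" for i j
  proof -
    have z: "cross3 y x \<bullet> x = 0" "x \<bullet> cross3 y x = 0" "cross3 y x \<bullet> y = 0" "y \<bullet> cross3 y x = 0" "y \<bullet> x = 0"
      using assms(3) by (simp_all add: dot_cross_self inner_commute [of y x])
    have d: "x \<bullet> x = norm x * norm x" "y \<bullet> y = norm y * norm y"
        "cross3 y x \<bullet> cross3 y x = (norm x * norm y) * (norm x * norm y)"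
      unfolding n [symmetric] by (simp_all add: dot_square_norm power2_eq_square)
    show ?thesis
      using exhaust_3 [of i] exhaust_3 [of j] assms
      by (elim disjE) (simp_all add: frame_col_def z d field_simps)
  qed
  moreover have "(ctranspose (frame x y) ** frame x y) $ i $ j = complex_of_real (frame_col x y i \<bullet> frame_col x y j)" for i j
    by (simp add: matrix_matrix_mult_def ctranspose_def frame_def inner_vec_def)
  ultimately have "ctranspose (frame x y) ** frame x y = mat 1"
    by (simp add: vec_eq_iff mat_def)
  then show ?thesis by (simp add: unitary_group_def matrix_left_right_inverse)
qed

lemma frame_nth:
  "frame x y $ i $ 1 = complex_of_real (x $ i / norm x)"
  "frame x y $ i $ 2 = complex_of_real (cross3 y x $ i / (norm x * norm y))"
  "frame x y $ i $ 3 = complex_of_real (y $ i / norm y)"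
  by (simp_all add: frame_def frame_col_def divide_inverse mult.commute)

text \<open>The 2 by 2 minors of the first two columns are, up to sign and scaling, the entries of
  \<open>cross3 x (cross3 y x)\<close>, which is \<open>(x \<bullet> x) *\<^sub>R y\<close> by
  orthogonality. The sign pattern of \<open>y\<close> makes them positive.\<close>

lemma frame_pos:
  assumes x: "\<And>i. 0 < x $ i" and y: "\<And>i. 0 < col3_sign i * y $ i" and o: "x \<bullet> y = 0"
  shows "frame x y \<in> unitary_pos"
proof -
  have nz: "x \<noteq> 0" "y \<noteq> 0" using x [of 1] y [of 1] by auto
  have y': "0 < y $ 1" "y $ 2 < 0" "0 < y $ 3"
    using y [of 1] y [of 2] y [of 3] by (auto simp: col3_sign_def)
  define c m n where "c = cross3 y x" and "m = norm x" and "n = norm y"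
  have mn: "m > 0" "n > 0" using nz by (simp_all add: m_def n_def)
  have o': "x $ 1 * y $ 1 + x $ 2 * y $ 2 + x $ 3 * y $ 3 = 0"
    using o by (simp add: inner_vec_def sum_3)
  have mm: "m * m = x $ 1 * x $ 1 + x $ 2 * x $ 2 + x $ 3 * x $ 3"
    and nn: "n * n = y $ 1 * y $ 1 + y $ 2 * y $ 2 + y $ 3 * y $ 3"
    using dot_square_norm [of x] dot_square_norm [of y]
    by (simp_all add: m_def n_def inner_vec_def sum_3 power2_eq_square)
  have c: "c $ 1 = y $ 2 * x $ 3 - x $ 2 * y $ 3" "c $ 2 = y $ 3 * x $ 1 - x $ 3 * y $ 1"
      "c $ 3 = y $ 1 * x $ 2 - x $ 1 * y $ 2"
    by (simp_all add: c_def cross_components)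
  have k: "x $ 1 * c $ 2 - c $ 1 * x $ 2 = y $ 3 * (m * m)"
      "x $ 1 * c $ 3 - c $ 1 * x $ 3 = - y $ 2 * (m * m)"
      "x $ 2 * c $ 3 - c $ 2 * x $ 3 = y $ 1 * (m * m)"
    unfolding c mm using o' by algebra+
  have minor: "frame x y $ i $ 1 * frame x y $ j $ 2 - frame x y $ i $ 2 * frame x y $ j $ 1
      = complex_of_real ((x $ i * c $ j - c $ i * x $ j) / (m * m * n))" for i j
    unfolding frame_nth of_real_mult [symmetric] of_real_diff [symmetric] of_real_eq_iff c_def m_def n_def
    by (simp add: diff_divide_distrib mult_ac)
  have det: "det (frame x y) = complex_of_real
      ((y $ 1 * (x $ 2 * c $ 3 - c $ 2 * x $ 3) - y $ 2 * (x $ 1 * c $ 3 - c $ 1 * x $ 3)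
        + y $ 3 * (x $ 1 * c $ 2 - c $ 1 * x $ 2)) / (m * m * (n * n)))"
    unfolding det_3 frame_nth of_real_mult [symmetric] of_real_add [symmetric] of_real_diff [symmetric] of_real_eq_iff
      c_def [symmetric] m_def [symmetric] n_def [symmetric]
    using mn by (simp add: field_simps)
  have "y $ 1 * (y $ 1 * (m * m)) - y $ 2 * (- y $ 2 * (m * m)) + y $ 3 * (y $ 3 * (m * m)) = m * m * (n * n)"
    unfolding nn by (simp add: algebra_simps)
  then have "det (frame x y) = 1"
    unfolding det k using mn by simp
  moreover have "frame x y $ 1 $ 1 * frame x y $ 2 $ 2 - frame x y $ 1 $ 2 * frame x y $ 2 $ 1 = complex_of_real (y $ 3 / n)"
      "frame x y $ 1 $ 1 * frame x y $ 3 $ 2 - frame x y $ 1 $ 2 * frame x y $ 3 $ 1 = complex_of_real (- y $ 2 / n)"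
      "frame x y $ 2 $ 1 * frame x y $ 3 $ 2 - frame x y $ 2 $ 2 * frame x y $ 3 $ 1 = complex_of_real (y $ 1 / n)"
    unfolding minor k using mn by simp_all
  moreover have "0 < complex_of_real r" if "r > 0" for r
    using that by (simp add: less_complex_def)
  moreover have "0 < (1 :: complex)" by (simp add: less_complex_def)
  moreover have "x $ i / norm x > 0" "- y $ 2 / n > 0" "y $ 1 / n > 0" "y $ 3 / n > 0" for i
    using x mn y' by (simp_all add: divide_neg_pos flip: m_def)
  ultimately show ?thesis
    unfolding unitary_pos_iff using frame_unitary [OF nz o] by (simp add: frame_nth(1) del: of_real_divide of_real_minus)
qed

section \<open>Boundary frames as limits of positive frames\<close>

lemma tendsto_conj_i_diag:
  assumes "(f \<longlongrightarrow> g) F"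
  shows "((\<lambda>t. f t ** i_diag l ** ctranspose (f t)) \<longlongrightarrow> g ** i_diag l ** ctranspose g) F"
  by (intro bounded_bilinear.tendsto [OF bounded_bilinear_matrix_mult] assms tendsto_const
      bounded_linear.tendsto [OF bounded_linear_ctranspose])

lemma tendsto_frame:
  assumes "(f \<longlongrightarrow> x) F" "(h \<longlongrightarrow> y) F" "x \<noteq> 0" "y \<noteq> 0"
  shows "((\<lambda>t. frame (f t) (h t)) \<longlongrightarrow> frame x y) F"
proof -
  have cr: "((\<lambda>t. cross3 (h t) (f t)) \<longlongrightarrow> cross3 y x) F"
    by (rule bounded_bilinear.tendsto [OF bilinear_cross [unfolded bilinear_conv_bounded_bilinear] assms(2,1)])
  have "((\<lambda>t. frame (f t) (h t) $ i $ j) \<longlongrightarrow> frame x y $ i $ j) F" for i j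
    using exhaust_3 [of j] assms
    by (elim disjE; hypsubst) (unfold frame_nth, (intro tendsto_intros cr; simp)+)
  then show ?thesis by (intro vec_tendstoI)
qed

text \<open>
  The perturbation applies the totally positive matrix with entries \<open>q ^ (i - j)\<^sup>2\<close> to \<open>x\<close>, and
  its cofactor matrix, divided by \<open>1 - q\<^sup>2\<close>, to \<open>y\<close>; this keeps the two vectors orthogonal.
\<close>

lemma frame_orbit_nonneg:
  assumes x: "\<And>i. 0 \<le> x $ i" and y: "\<And>i. 0 \<le> col3_sign i * y $ i" and o: "x \<bullet> y = 0"
    and nz: "x \<noteq> 0" "y \<noteq> 0"
  shows "frame x y ** i_diag l ** ctranspose (frame x y) \<in> orbit_nonneg l"
proof -
  define X where "X q = x + q *\<^sub>R vector [x $ 2, x $ 1 + x $ 3, x $ 2] + q ^ 4 *\<^sub>R vector [x $ 3, 0, x $ 1]"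
    for q :: real
  define Y where "Y q = y - (q * (1 + q\<^sup>2)) *\<^sub>R vector [y $ 2, y $ 1 + y $ 3, y $ 2] + q\<^sup>2 *\<^sub>R vector [y $ 3, 0, y $ 1]
      + ((1 + q\<^sup>2) * (1 + q ^ 4) - 1) *\<^sub>R vector [0, y $ 2, 0]" for q :: real
  have x': "0 \<le> x $ 1" "0 \<le> x $ 2" "0 \<le> x $ 3" "0 < x $ 1 \<or> 0 < x $ 2 \<or> 0 < x $ 3"
    using x nz(1) by (auto simp: vec_eq_iff forall_3 less_le)
  have y': "0 \<le> y $ 1" "0 \<le> - y $ 2" "0 \<le> y $ 3" "0 < y $ 1 \<or> 0 < - y $ 2 \<or> 0 < y $ 3"
    using y [of 1] y [of 2] y [of 3] nz(2) by (auto simp: vec_eq_iff forall_3 less_le col3_sign_def)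
  have comb: "0 < a * u + b * v + c * w"
    if "0 < a" "0 < b" "0 < c" "0 \<le> u" "0 \<le> v" "0 \<le> w" "0 < u \<or> 0 < v \<or> 0 < w" for a b c u v w :: real
  proof -
    have "0 \<le> a * u" "0 \<le> b * v" "0 \<le> c * w" "0 < a * u \<or> 0 < b * v \<or> 0 < c * w"
      using that by auto
    then show ?thesis by linarith
  qed
  have "frame (X q) (Y q) \<in> unitary_pos" if q: "q > 0" for q
  proof (rule frame_pos)
    have X: "X q $ 1 = 1 * x $ 1 + q * x $ 2 + q ^ 4 * x $ 3"
      "X q $ 2 = q * x $ 1 + 1 * x $ 2 + q * x $ 3"
      "X q $ 3 = q ^ 4 * x $ 1 + q * x $ 2 + 1 * x $ 3"
      by (simp_all add: X_def vector_3 algebra_simps)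
    \<comment> \<open>Written in \<open>y $ 1\<close>, \<open>- y $ 2\<close>, \<open>y $ 3\<close>,
      all coefficients are positive: the cofactors have the checkerboard signs that match
      \<open>col3_sign\<close>.\<close>
    have Y: "Y q $ 1 = 1 * y $ 1 + (q * (1 + q\<^sup>2)) * (- y $ 2) + q\<^sup>2 * y $ 3"
      "- Y q $ 2 = q * (1 + q\<^sup>2) * y $ 1 + (1 + q\<^sup>2) * (1 + q ^ 4) * (- y $ 2) + q * (1 + q\<^sup>2) * y $ 3"
      "Y q $ 3 = q\<^sup>2 * y $ 1 + (q * (1 + q\<^sup>2)) * (- y $ 2) + 1 * y $ 3"
      by (simp_all add: Y_def vector_3 algebra_simps)
    have "0 < X q $ 1" "0 < X q $ 2" "0 < X q $ 3"
      unfolding X using q x' by (intro comb; simp)+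
    then show "0 < X q $ i" for i using exhaust_3 [of i] by auto
    have p: "0 < q * (1 + q\<^sup>2)" "0 < q\<^sup>2" "0 < (1 + q\<^sup>2) * (1 + q ^ 4)"
      using q by (auto intro!: mult_pos_pos add_pos_nonneg)
    have "0 < Y q $ 1" "0 < - Y q $ 2" "0 < Y q $ 3"
      unfolding Y by (intro comb y' p; simp)+
    then show "0 < col3_sign i * Y q $ i" for i using exhaust_3 [of i] by (auto simp: col3_sign_def)
    have "x $ 1 * y $ 1 + x $ 2 * y $ 2 + x $ 3 * y $ 3 = 0"
      using o by (simp add: inner_vec_def sum_3)
    moreover have "X q \<bullet> Y q = X q $ 1 * Y q $ 1 - X q $ 2 * (- Y q $ 2) + X q $ 3 * Y q $ 3"
      by (simp add: inner_vec_def sum_3)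
    ultimately show "X q \<bullet> Y q = 0" unfolding X Y by algebra
  qed
  then have pos: "frame (X q) (Y q) ** i_diag l ** ctranspose (frame (X q) (Y q)) \<in> orbit_pos l" if "q > 0" for q
    using that unfolding orbit_pos_eq by blast
  have "(X \<longlongrightarrow> x + 0 *\<^sub>R vector [x $ 2, x $ 1 + x $ 3, x $ 2] + 0 ^ 4 *\<^sub>R vector [x $ 3, 0, x $ 1]) (at_right 0)"
    unfolding X_def by (intro tendsto_intros)
  moreover have "(Y \<longlongrightarrow> y - (0 * (1 + 0\<^sup>2)) *\<^sub>R vector [y $ 2, y $ 1 + y $ 3, y $ 2] + 0\<^sup>2 *\<^sub>R vector [y $ 3, 0, y $ 1]
      + ((1 + 0\<^sup>2) * (1 + 0 ^ 4) - 1) *\<^sub>R vector [0, y $ 2, 0]) (at_right 0)"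
    unfolding Y_def by (intro tendsto_intros)
  ultimately have "((\<lambda>q. frame (X q) (Y q)) \<longlongrightarrow> frame x y) (at_right 0)"
    using nz by (intro tendsto_frame) simp_all
  from tendsto_conj_i_diag [OF this]
  show ?thesis
    unfolding orbit_nonneg_def
    by (rule Lim_in_closed_set [OF closed_closure, rotated 2])
       (auto simp: eventually_at_right_field intro!: exI [of _ 1] pos closure_subset [THEN subsetD])
qed

section \<open>First-order conditions at the boundary\<close>

text \<open>
  For a unitary matrix the cofactors of the third column, which are left-justified minors, are
  proportional to the conjugates of its entries.
\<close>

lemma unitary_pos_col3:
  assumes g: "g \<in> unitary_pos"
  shows "0 < complex_of_real (col3_sign i) * g $ i $ 3"
proof -
  define w :: "3 \<Rightarrow> complex" where "w k = (if k = 1 then g $ 2 $ 1 * g $ 3 $ 2 - g $ 2 $ 2 * g $ 3 $ 1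
      else if k = 2 then - (g $ 1 $ 1 * g $ 3 $ 2 - g $ 1 $ 2 * g $ 3 $ 1)
      else g $ 1 $ 1 * g $ 2 $ 2 - g $ 1 $ 2 * g $ 2 $ 1)" for k
  have U: "g \<in> unitary_group" and d: "0 < det g" and w: "0 < complex_of_real (col3_sign i) * w i"
    using g exhaust_3 [of i] unfolding unitary_pos_iff by (auto simp: w_def col3_sign_def)
  \<comment> \<open>Laplace expansion along the third column, with that column replaced by column
    \<open>j\<close>; a repeated column gives 0.\<close>
  have ortho: "(\<Sum>k\<in>UNIV. g $ k $ j * w k) = (if j = 3 then det g else 0)" for j
    using exhaust_3 [of j] by (elim disjE) (simp_all add: sum_3 w_def det_3 algebra_simps)
  have "w i = (\<Sum>k\<in>UNIV. w k * (g ** ctranspose g) $ k $ i)"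
    unfolding unitaryD [OF U] by (simp add: mat_def if_distrib cong: if_cong)
  also have "\<dots> = (\<Sum>j\<in>UNIV. cnj (g $ i $ j) * (\<Sum>k\<in>UNIV. g $ k $ j * w k))"
    by (simp add: matrix_matrix_mult_def ctranspose_def sum_3 algebra_simps)
  also have "\<dots> = cnj (g $ i $ 3) * det g"
    by (simp add: ortho if_distrib cong: if_cong)
  finally have wi: "w i = cnj (g $ i $ 3) * det g" .
  obtain r where r: "det g = complex_of_real r" "r > 0"
    using d by (auto simp: less_complex_def complex_eq_iff intro: that [of "Re (det g)"])
  show ?thesis using w r by (auto simp: wi less_complex_def zero_less_mult_iff mult_less_0_iff col3_sign_def split: if_splits)
qed

text \<open>If \<open>c\<close> and \<open>d\<close> are two of the entries of \<open>l\<close>,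
  this is a multiple of the spectral projection for the third. Being polynomial in \<open>L\<close>,
  it is continuous and independent of the choice of frame. Since \<open>\<i> * \<i> = -1\<close>,
  the multiple is negative for the first and third projections of a decreasing \<open>l\<close>, so
  nonnegativity appears as \<open>\<le> 0\<close>.\<close>

definition two_eigen_factors :: "real \<Rightarrow> real \<Rightarrow> complex^3^3 \<Rightarrow> complex^3^3" where
  "two_eigen_factors c d L = (L - mat (\<i> * complex_of_real c)) ** (L - mat (\<i> * complex_of_real d))"

lemma two_eigen_factors_conj:
  assumes g: "g \<in> unitary_group"
  shows "two_eigen_factors c d (g ** i_diag l ** ctranspose g) $ i $ j
    = (\<Sum>k\<in>UNIV. - complex_of_real ((l $ k - c) * (l $ k - d)) * (g $ i $ k * cnj (g $ j $ k)))"
proof -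
  have shift: "g ** i_diag l ** ctranspose g - mat (\<i> * complex_of_real e) = g ** i_diag (\<chi> k. l $ k - e) ** ctranspose g" for e
  proof -
    have m: "mat (\<i> * complex_of_real e) = i_diag (\<chi> k. e)"
      by (simp add: mat_def i_diag_def vec_eq_iff)
    have "i_diag (\<chi> k. e) = g ** ctranspose g ** i_diag (\<chi> k. e)" by (simp add: unitaryD [OF g])
    also have "\<dots> = g ** (i_diag (\<chi> k. e) ** ctranspose g)"
    proof -
      have "ctranspose g ** i_diag (\<chi> k. e) = i_diag (\<chi> k. e) ** ctranspose g"
        by (simp add: vec_eq_iff mult_i_diag_nth mult_ac)
      then show ?thesis by (simp flip: matrix_mul_assoc)
    qed
    finally have "mat (\<i> * complex_of_real e) = g ** i_diag (\<chi> k. e) ** ctranspose g"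
      by (simp add: m matrix_mul_assoc)
    moreover have "i_diag (\<chi> k. l $ k - e) = i_diag l - i_diag (\<chi> k. e)"
      by (simp add: i_diag_def vec_eq_iff algebra_simps)
    ultimately show ?thesis by (simp add: matrix_mult_simps)
  qed
  have "two_eigen_factors c d (g ** i_diag l ** ctranspose g)
      = g ** i_diag (\<chi> k. l $ k - c) ** (i_diag (\<chi> k. l $ k - d) ** ctranspose g)"
    unfolding two_eigen_factors_def shift by (simp add: matrix_mult_simps unitaryD [OF g])
  also have "\<dots> $ i $ j = (\<Sum>k\<in>UNIV. (g ** i_diag (\<chi> k. l $ k - c)) $ i $ k * (i_diag (\<chi> k. l $ k - d) ** ctranspose g) $ k $ j)"
    by (subst matrix_matrix_mult_def) simp
  also have "\<dots> = (\<Sum>k\<in>UNIV. - complex_of_real ((l $ k - c) * (l $ k - d)) * (g $ i $ k * cnj (g $ j $ k)))"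
    by (intro sum.cong refl) (simp add: mult_i_diag_nth ctranspose_def algebra_simps)
  finally show ?thesis .
qed

lemma closed_two_eigen_factors_le_0:
  "closed {L. complex_of_real s * two_eigen_factors c d L $ i $ j \<le> 0}"
proof -
  have "continuous_on UNIV (two_eigen_factors c d)"
    unfolding two_eigen_factors_def
    by (intro bounded_bilinear.continuous_on [OF bounded_bilinear_matrix_mult] continuous_intros)
  then have "continuous_on UNIV (\<lambda>L. complex_of_real s * two_eigen_factors c d L $ i $ j)"
    by (intro continuous_intros)
  moreover have "closed {z :: complex. z \<le> 0}"
    unfolding less_eq_complex_def
    by (intro closed_Collect_conj closed_Collect_le closed_Collect_eq continuous_intros)
  ultimately have "closed ((\<lambda>L. complex_of_real s * two_eigen_factors c d L $ i $ j) -` {z. z \<le> 0})"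
    by (intro continuous_closed_vimage) (auto simp: continuous_on_eq_continuous_at)
  then show ?thesis by (simp add: vimage_def)
qed

lemma two_eigen_factors_cols:
  assumes "g \<in> unitary_group"
  shows "two_eigen_factors (l $ 2) (l $ 3) (g ** i_diag l ** ctranspose g) $ i $ j
      = - complex_of_real ((l $ 1 - l $ 2) * (l $ 1 - l $ 3)) * (g $ i $ 1 * cnj (g $ j $ 1))"
    "two_eigen_factors (l $ 1) (l $ 2) (g ** i_diag l ** ctranspose g) $ i $ j
      = - complex_of_real ((l $ 1 - l $ 3) * (l $ 2 - l $ 3)) * (g $ i $ 3 * cnj (g $ j $ 3))"
  unfolding two_eigen_factors_conj [OF assms] sum_3 by (simp_all add: algebra_simps)

lemma mult_pos_complex_nonneg_iff:
  assumes "r > 0"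
  shows "0 \<le> complex_of_real r * z \<longleftrightarrow> 0 \<le> z" "- complex_of_real r * z \<le> 0 \<longleftrightarrow> 0 \<le> z"
  using assms by (auto simp: less_eq_complex_def less_complex_def zero_le_mult_iff zero_less_mult_iff)

lemma unitary_pos_projections:
  assumes "g \<in> unitary_pos"
  shows "0 < g $ i $ 1 * cnj (g $ j $ 1)"
    "0 < complex_of_real (col3_sign i * col3_sign j) * (g $ i $ 3 * cnj (g $ j $ 3))"
proof -
  have pos: "0 < u * cnj v" if "0 < u" "0 < v" for u v :: complex
    using that by (auto simp: less_complex_def)
  show "0 < g $ i $ 1 * cnj (g $ j $ 1)"
    using assms by (intro pos) (auto simp: unitary_pos_iff)
  show "0 < complex_of_real (col3_sign i * col3_sign j) * (g $ i $ 3 * cnj (g $ j $ 3))"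
    using pos [OF unitary_pos_col3 [OF assms, of i] unitary_pos_col3 [OF assms, of j]] by (simp add: mult_ac)
qed

text \<open>The inequalities hold on \<open>orbit_pos l\<close> and define closed sets of
  \<open>L\<close>, so they pass to the closure. Products of two entries appear because
  \<open>L\<close> determines the columns of \<open>g\<close> only up to phases.\<close>

lemma orbit_nonneg_projections:
  assumes l: "l $ 1 > l $ 2" "l $ 2 > l $ 3" and g: "g \<in> unitary_group"
    and L: "g ** i_diag l ** ctranspose g \<in> orbit_nonneg l"
  shows "0 \<le> g $ i $ 1 * cnj (g $ j $ 1)"
    "0 \<le> complex_of_real (col3_sign i * col3_sign j) * (g $ i $ 3 * cnj (g $ j $ 3))"
proof -
  let ?p = "(l $ 1 - l $ 2) * (l $ 1 - l $ 3)" and ?q = "(l $ 1 - l $ 3) * (l $ 2 - l $ 3)"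
  let ?s = "col3_sign i * col3_sign j"
  have p: "?p > 0" and q: "?q > 0" using l by simp_all
  have "orbit_pos l \<subseteq> {L. complex_of_real 1 * two_eigen_factors (l $ 2) (l $ 3) L $ i $ j \<le> 0}"
  proof (clarsimp simp: orbit_pos_eq)
    fix h assume h: "h \<in> unitary_pos"
    then have U: "h \<in> unitary_group" by (simp add: unitary_pos_iff)
    show "two_eigen_factors (l $ 2) (l $ 3) (h ** i_diag l ** ctranspose h) $ i $ j \<le> 0"
      unfolding two_eigen_factors_cols [OF U] mult_pos_complex_nonneg_iff [OF p]
      using unitary_pos_projections(1) [OF h] by (rule less_imp_le)
  qed
  from closure_minimal [OF this closed_two_eigen_factors_le_0] L
  have "two_eigen_factors (l $ 2) (l $ 3) (g ** i_diag l ** ctranspose g) $ i $ j \<le> 0"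
    by (auto simp: orbit_nonneg_def)
  then show "0 \<le> g $ i $ 1 * cnj (g $ j $ 1)"
    unfolding two_eigen_factors_cols [OF g] mult_pos_complex_nonneg_iff [OF p] .
  have swap: "complex_of_real ?s * (- complex_of_real ?q * z) = - complex_of_real ?q * (complex_of_real ?s * z)" for z
    by simp
  have "orbit_pos l \<subseteq> {L. complex_of_real ?s * two_eigen_factors (l $ 1) (l $ 2) L $ i $ j \<le> 0}"
  proof
    fix M assume "M \<in> orbit_pos l"
    then obtain h where h: "h \<in> unitary_pos" and M: "M = h ** i_diag l ** ctranspose h"
      by (auto simp: orbit_pos_eq)
    then have U: "h \<in> unitary_group" by (simp add: unitary_pos_iff)
    show "M \<in> {L. complex_of_real ?s * two_eigen_factors (l $ 1) (l $ 2) L $ i $ j \<le> 0}"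
      unfolding M mem_Collect_eq two_eigen_factors_cols [OF U] swap mult_pos_complex_nonneg_iff [OF q]
      using unitary_pos_projections(2) [OF h] by (rule less_imp_le)
  qed
  from closure_minimal [OF this closed_two_eigen_factors_le_0] L
  have "complex_of_real ?s * two_eigen_factors (l $ 1) (l $ 2) (g ** i_diag l ** ctranspose g) $ i $ j \<le> 0"
    unfolding orbit_nonneg_def by blast
  then show "0 \<le> complex_of_real ?s * (g $ i $ 3 * cnj (g $ j $ 3))"
    unfolding two_eigen_factors_cols [OF g] swap mult_pos_complex_nonneg_iff [OF q] .
qed

section \<open>Velocities of vanishing entries\<close>

lemma right_derivative_nonneg:
  fixes h :: "real \<Rightarrow> complex"
  assumes d: "(h has_vector_derivative d) (at 0)" and nn: "\<And>t. t \<ge> 0 \<Longrightarrow> 0 \<le> h t" and h0: "h 0 = 0"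
  shows "0 \<le> d"
proof -
  have real: "0 \<le> D" if "(f has_real_derivative D) (at 0)" "\<And>t. t \<ge> 0 \<Longrightarrow> 0 \<le> f t" "f 0 = 0" for f D
  proof (rule ccontr)
    assume "\<not> 0 \<le> D"
    with DERIV_neg_dec_right [OF that(1)]
    obtain e where "e > 0" "\<And>t. t > 0 \<Longrightarrow> t < e \<Longrightarrow> f (0 + t) < f 0"
      by auto
    from this(2) [of "e / 2"] this(1) that(2) [of "e / 2"] that(3) show False by simp
  qed
  have Re: "((\<lambda>t. Re (h t)) has_real_derivative Re d) (at 0)" and Im: "((\<lambda>t. Im (h t)) has_real_derivative Im d) (at 0)"
    unfolding has_real_derivative_iff_has_vector_derivative
    using bounded_linear.has_vector_derivative [OF bounded_linear_Re d]
      bounded_linear.has_vector_derivative [OF bounded_linear_Im d] by simp_all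
  \<comment> \<open>The imaginary part is 0 for all \<open>t \<ge> 0\<close>, so the real case
    applies to it and to its negative.\<close>
  show ?thesis
    using real [OF Re] real [OF Im] real [OF DERIV_minus [OF Im]] nn h0
    by (simp add: less_eq_complex_def)
qed

text \<open>Along the lifted trajectory an entry of a spectral projection stays nonnegative, up to
  the sign pattern, and starts at 0. In the product rule only the term with the velocity of the
  vanishing factor remains.\<close>

lemma weakly_preserves_imp_field_nonneg:
  assumes l: "l $ 1 > l $ 2" "l $ 2 > l $ 3" and N: "N \<in> skew_hermitian"
    and w: "weakly_preserves_positivity l N"
    and g: "g \<in> unitary_group" and L: "g ** i_diag l ** ctranspose g \<in> orbit_nonneg l"
  shows "g $ i $ 1 = 0 \<Longrightarrow> 0 \<le> orbit_field l N g $ i $ 1 * cnj (g $ j $ 1)"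
    and "g $ i $ 3 = 0 \<Longrightarrow>
      0 \<le> complex_of_real (col3_sign i * col3_sign j) * (orbit_field l N g $ i $ 3 * cnj (g $ j $ 3))"
proof -
  have inj: "i \<noteq> j \<Longrightarrow> l $ i \<noteq> l $ j" for i j
    using l exhaust_3 [of i] exhaust_3 [of j] by auto
  obtain G where G: "G 0 = g" "\<And>t. G t \<in> unitary_group"
    and d: "\<And>t. (G has_vector_derivative orbit_field l N (G t)) (at t)"
    and tr: "gradient_trajectory l N (\<lambda>t. G t ** i_diag l ** ctranspose (G t))"
    using orbit_flow_exists [OF inj N g] by blast
  have nn: "G t ** i_diag l ** ctranspose (G t) \<in> orbit_nonneg l" if "t \<ge> 0" for t
    using w tr L that G(1) unfolding weakly_preserves_positivity_def by blast
  have dk: "((\<lambda>t. G t $ i $ k * cnj (G t $ j $ k)) has_vector_derivative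
      g $ i $ k * cnj (orbit_field l N g $ j $ k) + orbit_field l N g $ i $ k * cnj (g $ j $ k)) (at 0)" for k
  proof -
    have e: "((\<lambda>t. G t $ p $ k) has_vector_derivative orbit_field l N g $ p $ k) (at 0)" for p
      using bounded_linear.has_vector_derivative [OF bounded_linear_vec_nth
          bounded_linear.has_vector_derivative [OF bounded_linear_vec_nth d [of 0]]] G(1) by simp
    show ?thesis
      using has_vector_derivative_mult [OF e [of i] bounded_linear.has_vector_derivative [OF bounded_linear_cnj e [of j]]]
        G(1) by simp
  qed
  show "0 \<le> orbit_field l N g $ i $ 1 * cnj (g $ j $ 1)" if "g $ i $ 1 = 0"
    using right_derivative_nonneg [OF dk [of 1]] orbit_nonneg_projections(1) [OF l G(2) nn] G(1) that by simp
  show "0 \<le> complex_of_real (col3_sign i * col3_sign j) * (orbit_field l N g $ i $ 3 * cnj (g $ j $ 3))"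
    if "g $ i $ 3 = 0"
    using right_derivative_nonneg [OF has_vector_derivative_mult_right [OF dk [of 3],
          of "complex_of_real (col3_sign i * col3_sign j)"]]
      orbit_nonneg_projections(2) [OF l G(2) nn] G(1) that by simp
qed

text \<open>The bilinear form of \<open>T = \<i> N\<close> on real vectors. For skew-Hermitian
  \<open>N\<close> the matrix \<open>T\<close> is Hermitian, so its diagonal is real.\<close>

definition hform :: "complex^3^3 \<Rightarrow> real^3 \<Rightarrow> real^3 \<Rightarrow> complex" where
  "hform N u v = (\<Sum>p\<in>UNIV. \<Sum>q\<in>UNIV. complex_of_real (u $ p * v $ q) * (\<i> * N $ p $ q))"

lemma hform_scale: "hform N (u /\<^sub>R r) (v /\<^sub>R s) = hform N u v / complex_of_real (r * s)"
  by (simp add: hform_def sum_3 divide_inverse algebra_simps)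

lemma frame_conj: "(ctranspose (frame x y) ** N ** frame x y) $ j $ k
    = - \<i> * hform N (frame_col x y j) (frame_col x y k)"
  by (simp add: matrix_matrix_mult_def ctranspose_def frame_def hform_def sum_3 algebra_simps)

text \<open>As in first-order perturbation theory, a column moves along the two others, weighted by
  inverse eigenvalue gaps. The gaps are written so that they are positive for decreasing
  \<open>l\<close>.\<close>

lemma orbit_field_frame:
  "orbit_field l N (frame x y) $ i $ 1 =
     complex_of_real (frame_col x y 2 $ i / (l $ 1 - l $ 2)) * hform N (frame_col x y 2) (frame_col x y 1)
     + complex_of_real (frame_col x y 3 $ i / (l $ 1 - l $ 3)) * hform N (frame_col x y 3) (frame_col x y 1)"
  "orbit_field l N (frame x y) $ i $ 3 =
     - complex_of_real (frame_col x y 1 $ i / (l $ 1 - l $ 3)) * hform N (frame_col x y 1) (frame_col x y 3)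
     - complex_of_real (frame_col x y 2 $ i / (l $ 2 - l $ 3)) * hform N (frame_col x y 2) (frame_col x y 3)"
proof -
  have d: "z / (complex_of_real p - complex_of_real q) = - (z / (complex_of_real q - complex_of_real p))" for z p q
    by (simp flip: divide_minus_right)
  have A: "ad_diag_inv l (ctranspose (frame x y) ** N ** frame x y) $ j $ k =
      (if j = k then 0 else - (hform N (frame_col x y j) (frame_col x y k) / complex_of_real (l $ j - l $ k)))" for j k
    by (simp add: ad_diag_inv_def frame_conj)
  have e: "orbit_field l N (frame x y) $ i $ k =
    (\<Sum>j\<in>UNIV. complex_of_real (frame_col x y j $ i) * ad_diag_inv l (ctranspose (frame x y) ** N ** frame x y) $ j $ k)" for k
    unfolding orbit_field_def by (subst matrix_matrix_mult_def) (simp add: frame_def)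
  show "orbit_field l N (frame x y) $ i $ 1 =
     complex_of_real (frame_col x y 2 $ i / (l $ 1 - l $ 2)) * hform N (frame_col x y 2) (frame_col x y 1)
     + complex_of_real (frame_col x y 3 $ i / (l $ 1 - l $ 3)) * hform N (frame_col x y 3) (frame_col x y 1)"
    unfolding e A sum_3 by (simp add: d [of _ "l $ 2" "l $ 1"] d [of _ "l $ 3" "l $ 1"])
  show "orbit_field l N (frame x y) $ i $ 3 =
     - complex_of_real (frame_col x y 1 $ i / (l $ 1 - l $ 3)) * hform N (frame_col x y 1) (frame_col x y 3)
     - complex_of_real (frame_col x y 2 $ i / (l $ 2 - l $ 3)) * hform N (frame_col x y 2) (frame_col x y 3)"
    unfolding e A sum_3 by simp
qed

lemma nonneg_combination_rescale:
  assumes "0 \<le> complex_of_real p * A + complex_of_real q * B" "r > 0"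
    "r * p = p'" "r * q = q'"
  shows "0 \<le> complex_of_real p' * A + complex_of_real q' * B"
proof -
  have "0 \<le> complex_of_real r * (complex_of_real p * A + complex_of_real q * B)"
    using assms by (simp add: mult_pos_complex_nonneg_iff)
  then show ?thesis by (simp add: algebra_simps flip: assms(3,4))
qed

text \<open>Pairing the vanishing entry with a nonzero entry of the same column gives a condition on
  its velocity alone. Clearing denominators leaves a form for unnormalised vectors, into which
  explicit flags can be inserted.\<close>

lemma weakly_preserves_frame:
  assumes l: "l $ 1 > l $ 2" "l $ 2 > l $ 3" and N: "N \<in> skew_hermitian"
    and w: "weakly_preserves_positivity l N"
    and x: "\<forall>i. 0 \<le> x $ i" and y: "\<forall>i. 0 \<le> col3_sign i * y $ i" and o: "x \<bullet> y = 0"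
    and nz: "x \<noteq> 0" "y \<noteq> 0"
  shows "x $ i = 0 \<Longrightarrow> 0 \<le> complex_of_real ((l $ 1 - l $ 3) * cross3 y x $ i) * hform N (cross3 y x) x
       + complex_of_real ((l $ 1 - l $ 2) * (x \<bullet> x) * y $ i) * hform N y x"
    and "y $ i = 0 \<Longrightarrow> 0 \<le> complex_of_real (- col3_sign i * (l $ 2 - l $ 3) * (y \<bullet> y) * x $ i) * hform N x y
       + complex_of_real (- col3_sign i * (l $ 1 - l $ 3) * cross3 y x $ i) * hform N (cross3 y x) y"
proof -
  define m n c where "m = norm x" and "n = norm y" and "c = cross3 y x"
  have mn: "m > 0" "n > 0" using nz by (simp_all add: m_def n_def)
  have xx: "x \<bullet> x = m * m" and yy: "y \<bullet> y = n * n"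
    by (simp_all add: m_def n_def dot_square_norm power2_eq_square)
  have col: "frame_col x y 1 = x /\<^sub>R m" "frame_col x y 2 = c /\<^sub>R (m * n)" "frame_col x y 3 = y /\<^sub>R n"
    by (simp_all add: frame_col_def m_def n_def c_def)
  have U: "frame x y \<in> unitary_group" by (rule frame_unitary [OF nz o])
  have L: "frame x y ** i_diag l ** ctranspose (frame x y) \<in> orbit_nonneg l"
    using x y by (intro frame_orbit_nonneg o nz) auto
  note F = weakly_preserves_imp_field_nonneg [OF l N w U L]
  define a b d where "a = l $ 1 - l $ 2" and "b = l $ 2 - l $ 3" and "d = l $ 1 - l $ 3"
  have lp: "a > 0" "b > 0" "d > 0" using l by (simp_all add: a_def b_def d_def)
  note abd = a_def [symmetric] b_def [symmetric] d_def [symmetric]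
  show "0 \<le> complex_of_real ((l $ 1 - l $ 3) * c $ i) * hform N c x
       + complex_of_real ((l $ 1 - l $ 2) * (x \<bullet> x) * y $ i) * hform N y x" if "x $ i = 0"
  proof -
    obtain j where "x $ j \<noteq> 0" using nz(1) by (auto simp: vec_eq_iff)
    then have xj: "x $ j > 0" using x by (simp add: less_le)
    \<comment> \<open>This positive factor cancels \<open>x $ j\<close>, the norms and the gaps; its
      analogue in the second half uses the signed entry \<open>?y\<close>.\<close>
    let ?r = "a * d * m ^ 4 * n\<^sup>2 / x $ j"
    have "0 \<le> complex_of_real (c $ i * x $ j / (a * m ^ 4 * n\<^sup>2)) * hform N c x
        + complex_of_real (y $ i * x $ j / (d * m\<^sup>2 * n\<^sup>2)) * hform N y x"
      using F(1) [of i j] that unfolding orbit_field_frame frame_nth col hform_scale abd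
      by (simp add: m_def [symmetric] divide_inverse algebra_simps power2_eq_square power4_eq_xxxx)
    then show ?thesis
      by (rule nonneg_combination_rescale [where r = ?r])
         (use lp mn xj in \<open>simp_all add: xx abd divide_simps power2_eq_square power4_eq_xxxx\<close>)
  qed
  show "0 \<le> complex_of_real (- col3_sign i * (l $ 2 - l $ 3) * (y \<bullet> y) * x $ i) * hform N x y
       + complex_of_real (- col3_sign i * (l $ 1 - l $ 3) * c $ i) * hform N c y" if "y $ i = 0"
  proof -
    obtain j where "y $ j \<noteq> 0" using nz(2) by (auto simp: vec_eq_iff)
    then have yj: "col3_sign j * y $ j > 0" using y by (simp add: less_le col3_sign_def)
    then have ne: "col3_sign j \<noteq> 0" "y $ j \<noteq> 0" by auto
    let ?s = "col3_sign i" and ?y = "col3_sign j * y $ j"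
    let ?r = "b * d * n ^ 4 * m\<^sup>2 / ?y"
    have "0 \<le> complex_of_real (- ?s * x $ i * ?y / (d * m\<^sup>2 * n\<^sup>2)) * hform N x y
        + complex_of_real (- ?s * c $ i * ?y / (b * m\<^sup>2 * n ^ 4)) * hform N c y"
      using F(2) [of i j] that unfolding orbit_field_frame frame_nth col hform_scale abd
      by (simp add: n_def [symmetric] divide_inverse algebra_simps power2_eq_square power4_eq_xxxx)
    then show ?thesis
      by (rule nonneg_combination_rescale [where r = ?r])
         (use lp mn yj ne in \<open>simp_all add: yy abd divide_simps power2_eq_square power4_eq_xxxx\<close>)
  qed
qed

text \<open>At the best ratio \<open>p : q\<close> the assumptions become
  \<open>b * v \<le> 2 * s * u\<close> and \<open>b * u \<le> 2 * s * v\<close> with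
  \<open>s = sqrt (a * (a + b))\<close>. Their sum forces \<open>u + v \<le> 0\<close>, because the
  bound on \<open>a / b\<close> means \<open>2 * s < b\<close>.\<close>

lemma nonneg_pair_eq_zero:
  fixes a b u v :: real
  assumes a: "a > 0" and b: "b > 0" and r: "a / b < 1 / (2 + 2 * sqrt 2)" and uv: "u \<ge> 0" "v \<ge> 0"
    and 1: "\<And>p q. p > 0 \<Longrightarrow> q > 0 \<Longrightarrow> 0 \<le> u * (a * p\<^sup>2 + (a + b) * q\<^sup>2) - b * p * q * v"
    and 2: "\<And>p q. p > 0 \<Longrightarrow> q > 0 \<Longrightarrow> 0 \<le> v * ((a + b) * p\<^sup>2 + a * q\<^sup>2) - b * p * q * u"
  shows "u = 0 \<and> v = 0"
proof -
  define s where "s = sqrt a * sqrt (a + b)"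
  have s: "s > 0" "s * s = a * (a + b)"
    using a b by (simp_all add: s_def algebra_simps)
  have "1 / (2 + 2 * sqrt 2) = (sqrt 2 - 1) / 2"
    using add_pos_pos [of 2 "2 * sqrt 2"] by (simp add: divide_simps algebra_simps)
  with r b have "2 * a + b < sqrt 2 * b" by (simp add: field_simps)
  \<comment> \<open>Completing the square:
    \<open>4 * a * (a + b) = (2 * a + b)\<^sup>2 - b\<^sup>2\<close>.\<close>
  then have "(2 * a + b)\<^sup>2 < (sqrt 2 * b)\<^sup>2" using a b by (intro power_strict_mono) auto
  then have "(2 * s)\<^sup>2 < b\<^sup>2"
    using s(2) by (simp add: power2_eq_square algebra_simps)
  then have sb: "2 * s < b" using power_less_imp_less_base [of "2 * s" 2 b] b by simp
  \<comment> \<open>These \<open>p\<close> and \<open>q\<close> give equality in the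
    arithmetic-geometric mean inequality for \<open>a * p\<^sup>2\<close> and
    \<open>(a + b) * q\<^sup>2\<close>.\<close>
  have "0 \<le> 2 * (a * (a + b)) * u - b * s * v"
    using 1 [of "sqrt (a + b)" "sqrt a"] a b by (simp add: s_def algebra_simps)
  then have "0 \<le> s * (2 * s * u - b * v)"
    unfolding s(2) [symmetric] by (simp add: algebra_simps)
  then have uv1: "b * v \<le> 2 * s * u" using s(1) by (simp add: zero_le_mult_iff)
  have "0 \<le> 2 * (a * (a + b)) * v - b * s * u"
    using 2 [of "sqrt a" "sqrt (a + b)"] a b by (simp add: s_def algebra_simps)
  then have "0 \<le> s * (2 * s * v - b * u)"
    unfolding s(2) [symmetric] by (simp add: algebra_simps)
  then have uv2: "b * u \<le> 2 * s * v" using s(1) by (simp add: zero_le_mult_iff)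
  have "(b - 2 * s) * (u + v) \<le> 0" using uv1 uv2 by (simp add: algebra_simps)
  then have "u + v \<le> 0" using sb by (simp add: mult_le_0_iff)
  then show ?thesis using uv by simp
qed

section \<open>Scalar matrices are the only weakly positive ones\<close>

lemma weakly_preserves_imp_scalar:
  fixes l :: "real^3"
  assumes l: "l $ 1 > l $ 2" "l $ 2 > l $ 3"
    and ratio: "(l $ 1 - l $ 2) / (l $ 2 - l $ 3) \<notin> {1 / (2 + 2 * sqrt 2) .. 2 + 2 * sqrt 2}"
    and N: "N \<in> skew_hermitian" and w: "weakly_preserves_positivity l N"
  shows "\<exists>c. N = mat c"
proof -
  define a b where "a = l $ 1 - l $ 2" and "b = l $ 2 - l $ 3"
  have ab: "a > 0" "b > 0" using l by (simp_all add: a_def b_def)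
  have abd: "l $ 1 - l $ 2 = a" "l $ 2 - l $ 3 = b" "l $ 1 - l $ 3 = a + b" by (simp_all add: a_def b_def)
  define t where "t p q = \<i> * N $ p $ q" for p q
  have herm: "t q p = cnj (t p q)" for p q
  proof -
    have "cnj (N $ p $ q) = ctranspose N $ q $ p" by (simp add: ctranspose_def)
    also have "\<dots> = - N $ q $ p" using N by (simp add: skew_hermitian_def)
    finally show ?thesis by (simp add: t_def)
  qed
  have diag: "Im (t p p) = 0" for p
    using arg_cong [OF herm [of p p], of Im] by simp
  have hform: "hform N u v = (\<Sum>p\<in>UNIV. \<Sum>q\<in>UNIV. complex_of_real (u $ p * v $ q) * t p q)" for u v
    by (simp add: hform_def t_def)
  note expand = hform sum_3 cross_components vector_3 inner_vec_def col3_sign_def forall_3 vec_eq_iff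
  note col1 = weakly_preserves_frame(1) [OF l N w, unfolded abd]
  note col3 = weakly_preserves_frame(2) [OF l N w, unfolded abd]

  have "0 \<le> complex_of_real a * t 1 2"
    using col1 [of "vector [0, 1, 0]" "vector [1, 0, 0]" 1] by (simp add: expand)
  then have t12: "0 \<le> t 1 2" using ab by (simp add: mult_pos_complex_nonneg_iff)
  have "0 \<le> complex_of_real a * t 3 2"
    using col1 [of "vector [0, 1, 0]" "vector [0, 0, 1]" 3] by (simp add: expand)
  then have t32: "0 \<le> t 3 2" using ab by (simp add: mult_pos_complex_nonneg_iff)
  \<comment> \<open>At this flag both columns have a vanishing entry in a corner row. They bound
    \<open>t 1 3\<close> and its conjugate \<open>t 3 1\<close> from opposite sides.\<close>
  have "0 \<le> complex_of_real a * t 1 3"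
    using col1 [of "vector [0, 0, 1]" "vector [1, 0, 0]" 1] by (simp add: expand)
  moreover have "0 \<le> - (complex_of_real b * t 3 1)"
    using col3 [of "vector [0, 0, 1]" "vector [1, 0, 0]" 3] by (simp add: expand)
  ultimately have t13: "t 1 3 = 0"
    using ab herm [of 3 1]
    by (auto simp: less_eq_complex_def complex_eq_iff zero_le_mult_iff mult_le_0_iff)
  obtain u v where u: "t 1 2 = complex_of_real u" "u \<ge> 0" and v: "t 3 2 = complex_of_real v" "v \<ge> 0"
    using t12 t32 by (auto simp: less_eq_complex_def complex_eq_iff intro: that [of "Re (t 1 2)" "Re (t 3 2)"])
  have t21: "t 2 1 = complex_of_real u" and t23: "t 2 3 = complex_of_real v" and t31: "t 3 1 = 0"
    using herm [of 2 1] herm [of 2 3] herm [of 3 1] by (simp_all add: u v t13)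

  have "u = 0 \<and> v = 0"
  proof (cases "a / b < 1 / (2 + 2 * sqrt 2)")
    case True
    show ?thesis
    proof (rule nonneg_pair_eq_zero [OF ab True u(2) v(2)])
      fix p q :: real assume pq: "p > 0" "q > 0"
      have "0 \<le> complex_of_real (u * (a * p\<^sup>2 + (a + b) * q\<^sup>2) - b * p * q * v)"
        using col1 [of "vector [0, 1, 0]" "vector [p, 0, q]" 1] pq
        by (simp add: expand u v algebra_simps power2_eq_square)
      then show "0 \<le> u * (a * p\<^sup>2 + (a + b) * q\<^sup>2) - b * p * q * v"
        by (simp add: less_eq_complex_def)
      have "0 \<le> complex_of_real (v * ((a + b) * p\<^sup>2 + a * q\<^sup>2) - b * p * q * u)"
        using col1 [of "vector [0, 1, 0]" "vector [p, 0, q]" 3] pq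
        by (simp add: expand u v algebra_simps power2_eq_square)
      then show "0 \<le> v * ((a + b) * p\<^sup>2 + a * q\<^sup>2) - b * p * q * u"
        by (simp add: less_eq_complex_def)
    qed
  next
    case False
    \<comment> \<open>The endpoints of the excluded interval are reciprocal, so \<open>b / a\<close>
      now satisfies the bound of the first case. Flags with \<open>y = - e\<^sub>2\<close> exchange
      the roles of \<open>a\<close> and \<open>b\<close>.\<close>
    then have "a / b > 2 + 2 * sqrt 2" using ratio by (simp add: a_def b_def)
    moreover have "2 + 2 * sqrt 2 > 0" by (simp add: add_pos_pos)
    ultimately have True: "b / a < 1 / (2 + 2 * sqrt 2)"
      using ab by (simp add: field_simps)
    show ?thesis
    proof (rule nonneg_pair_eq_zero [OF ab(2,1) True u(2) v(2)])
      fix p q :: real assume pq: "p > 0" "q > 0"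
      have "0 \<le> complex_of_real (u * (b * p\<^sup>2 + (b + a) * q\<^sup>2) - a * p * q * v)"
        using col3 [of "vector [p, 0, q]" "vector [0, -1, 0]" 1] pq
        by (simp add: expand u v t21 t23 algebra_simps power2_eq_square)
      then show "0 \<le> u * (b * p\<^sup>2 + (b + a) * q\<^sup>2) - a * p * q * v"
        by (simp add: less_eq_complex_def)
      have "0 \<le> complex_of_real (v * ((b + a) * p\<^sup>2 + b * q\<^sup>2) - a * p * q * u)"
        using col3 [of "vector [p, 0, q]" "vector [0, -1, 0]" 3] pq
        by (simp add: expand u v t21 t23 algebra_simps power2_eq_square)
      then show "0 \<le> v * ((b + a) * p\<^sup>2 + b * q\<^sup>2) - a * p * q * u"
        by (simp add: less_eq_complex_def)
    qed
  qed
  then have off: "t 1 2 = 0" "t 2 1 = 0" "t 1 3 = 0" "t 3 1 = 0" "t 2 3 = 0" "t 3 2 = 0"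
    by (simp_all add: u v t21 t23 t31 t13)

  \<comment> \<open>Now \<open>T\<close> is diagonal. For each pair of neighbouring diagonal
    entries, a flag with a zero in its first column and one with a zero in its third give opposite
    inequalities.\<close>
  have "0 \<le> b * (Re (t 2 2) - Re (t 3 3))"
    using col1 [of "vector [0, 1, 1]" "vector [1, -1, 1]" 1]
    by (simp add: expand off less_eq_complex_def algebra_simps)
  moreover have "0 \<le> a * (Re (t 3 3) - Re (t 2 2))"
    using col3 [of "vector [1, 1, 1]" "vector [0, -1, 1]" 1]
    by (simp add: expand off less_eq_complex_def algebra_simps)
  ultimately have "Re (t 2 2) = Re (t 3 3)" using ab by (simp add: zero_le_mult_iff)
  moreover have "0 \<le> b * (Re (t 2 2) - Re (t 1 1))"
    using col1 [of "vector [1, 1, 0]" "vector [1, -1, 1]" 3]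
    by (simp add: expand off less_eq_complex_def algebra_simps)
  moreover have "0 \<le> a * (Re (t 1 1) - Re (t 2 2))"
    using col3 [of "vector [1, 1, 1]" "vector [1, -1, 0]" 3]
    by (simp add: expand off less_eq_complex_def algebra_simps)
  ultimately have "t 2 2 = t 1 1" "t 3 3 = t 1 1"
    using ab diag by (auto simp: zero_le_mult_iff complex_eq_iff)
  with off have "N = mat (N $ 1 $ 1)"
    by (simp add: t_def vec_eq_iff forall_3 mat_def)
  then show ?thesis by blast
qed

section \<open>From the classification to the preservation properties\<close>

lemma constant_flow_imp_weakly_preserves:
  "constant_flow l N \<Longrightarrow> weakly_preserves_positivity l N"
  unfolding constant_flow_def weakly_preserves_positivity_def by metis

lemma strictly_preserves_imp_weakly_preserves:
  assumes "strictly_preserves_positivity l N"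
  shows "weakly_preserves_positivity l N"
  unfolding weakly_preserves_positivity_def
proof (intro allI impI)
  fix L t assume L: "gradient_trajectory l N L \<and> L 0 \<in> orbit_nonneg l" and t: "t \<ge> (0::real)"
  show "L t \<in> orbit_nonneg l"
  proof (cases "t = 0")
    case False
    then have "L t \<in> orbit_pos l"
      using assms L t unfolding strictly_preserves_positivity_def by simp
    then show ?thesis unfolding orbit_nonneg_def by (rule closure_subset [THEN subsetD])
  qed (use L in simp)
qed

text \<open>A constant flow started at the boundary flag \<open>x = e\<^sub>2\<close>,
  \<open>y = e\<^sub>1\<close> stays there. Entry (1, 2) of its first spectral projection is 0,
  whereas on \<open>orbit_pos l\<close> it is positive.\<close>

lemma not_strictly_preserves_scalar:
  assumes l: "l $ 1 > l $ 2" "l $ 2 > l $ 3" and N: "mat c \<in> skew_hermitian"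
  shows "\<not> strictly_preserves_positivity l (mat c)"
proof
  assume strict: "strictly_preserves_positivity l (mat c)"
  let ?x = "vector [0, 1, 0] :: real^3" and ?y = "vector [1, 0, 0] :: real^3"
  let ?L0 = "frame ?x ?y ** i_diag l ** ctranspose (frame ?x ?y)"
  have xy: "?x \<noteq> 0" "?y \<noteq> 0" "?x \<bullet> ?y = 0"
    by (simp_all add: vec_eq_iff forall_3 vector_3 inner_vec_def sum_3)
  have U: "frame ?x ?y \<in> unitary_group" by (rule frame_unitary [OF xy])
  have nonneg: "?L0 \<in> orbit_nonneg l"
  proof (rule frame_orbit_nonneg [OF _ _ xy(3,1,2)])
    show "0 \<le> ?x $ i" "0 \<le> col3_sign i * ?y $ i" for i
      using exhaust_3 [of i] by (auto simp: vector_3 col3_sign_def)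
  qed
  have inj: "i \<noteq> j \<Longrightarrow> l $ i \<noteq> l $ j" for i j
    using l exhaust_3 [of i] exhaust_3 [of j] by auto
  have "?L0 \<in> orbit l" using U by (auto simp: orbit_eq)
  then obtain L where L: "gradient_trajectory l (mat c) L" "L 0 = ?L0"
    using orbit_trajectory_exists [OF inj N] by blast
  then have "L 1 = ?L0" using scalar_constant_flow unfolding constant_flow_def by metis
  then have "?L0 \<in> orbit_pos l"
    using strict L nonneg unfolding strictly_preserves_positivity_def by (metis zero_less_one)
  then obtain h where h: "h \<in> unitary_pos" and eq: "?L0 = h ** i_diag l ** ctranspose h"
    by (auto simp: orbit_pos_eq)
  then have H: "h \<in> unitary_group" by (simp add: unitary_pos_iff)
  have "complex_of_real ((l $ 1 - l $ 2) * (l $ 1 - l $ 3)) * (h $ 1 $ 1 * cnj (h $ 2 $ 1)) = 0"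
    using two_eigen_factors_cols(1) [OF U, of l 1 2] two_eigen_factors_cols(1) [OF H, of l 1 2]
    by (simp add: eq frame_nth vector_3)
  then have "h $ 1 $ 1 * cnj (h $ 2 $ 1) = 0" using l by simp
  with unitary_pos_projections(1) [OF h, of 1 2] show False by simp
qed

text \<open>Strict preservation implies weak preservation, hence a scalar \<open>N\<close>, for
  which it fails. A constant flow preserves positivity weakly, which closes the circle of
  equivalences.\<close>

theorem proposition5p36:
  fixes l :: "real^3" and N :: "complex^3^3"
  assumes "l $ 1 > l $ 2" and "l $ 2 > l $ 3"
    and "(l $ 1 - l $ 2) / (l $ 2 - l $ 3) \<notin> {1 / (2 + 2 * sqrt 2) .. 2 + 2 * sqrt 2}"
    and "N \<in> skew_hermitian"
  shows "\<not> strictly_preserves_positivity l N \<and>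
         (weakly_preserves_positivity l N \<longleftrightarrow> (\<exists>c::complex. N = mat c)) \<and>
         ((\<exists>c::complex. N = mat c) \<longleftrightarrow> constant_flow l N)"
  using weakly_preserves_imp_scalar [OF assms] scalar_constant_flow [of l]
    constant_flow_imp_weakly_preserves [of l N] strictly_preserves_imp_weakly_preserves [of l N]
    not_strictly_preserves_scalar [OF assms(1,2)] assms(4)
  by metis

end
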